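(* Let $G$ be a graph that contains neither $P_2\cup P_4$ nor the bull as an induced subgraph, and suppose that $\omega(G)\geq 3$. Then either $G$ contains a homogeneous set or $G$ has a perfect division.
   Context: All graphs are finite and simple. $\omega(G)$ denotes the clique number of $G$, and $G[X]$ denotes the subgraph of $G$ induced by $X\subseteq V(G)$. $P_k$ is the path on $k$ vertices, and $P_2\cup P_4$ is the vertex-disjoint union of $P_2$ and $P_4$ with no edges between them. The bull is the graph with vertex set $\{x_1,x_2,x_3,y,z\}$ and edge set $\{x_1x_2,x_1x_3,x_2x_3,x_1y,x_2z\}$ (a triangle with two disjoint pendant edges). For disjoint vertex sets $A,B$, $A$ is complete (respectively, anticomplete) to $B$ if every vertex of $A$ is adjacent (respectively, nonadjacent) to every vertex of $B$. A homogeneous set of $G$ is a set $X\subseteq V(G)$ with $1<|X|<|V(G)|$ such that every vertex of $V(G)\setminus X$ is either complete or anticomplete to $X$. A graph $G$ is perfect if $\chi(H)=\omega(H)$ for every induced subgraph $H$ of $G$. A graph $G$ has a perfect division if $V(G)$ can be partitioned into two sets $A$ and $B$ (either of which may be empty, with the clique number of the empty graph being $0$) such that $G[A]$ is perfect and $\omega(G[B])<\omega(G)$. *)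

theory Defs
  imports Main "HOL-Library.FuncSet" "HOL-Library.Ramsey"
begin

record 'a ugraph =
  verts :: "'a set"
  edges :: "'a set set"

definition simple_graph :: "'a ugraph \<Rightarrow> bool" where
  "simple_graph G \<longleftrightarrow> finite (verts G) \<and> edges G \<subseteq> [verts G]\<^bsup>2\<^esup>"

definition induced :: "'a ugraph \<Rightarrow> 'a set \<Rightarrow> 'a ugraph" where
  "induced G X = \<lparr>verts = X, edges = {e \<in> edges G. e \<subseteq> X}\<rparr>"

definition isomorphic :: "'a ugraph \<Rightarrow> 'b ugraph \<Rightarrow> bool" where
  "isomorphic G H \<longleftrightarrow>
     (\<exists>f. bij_betw f (verts G) (verts H) \<and>
          (\<forall>u\<in>verts G. \<forall>v\<in>verts G. {u, v} \<in> edges G \<longleftrightarrow> {f u, f v} \<in> edges H))"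

definition contains_induced :: "'a ugraph \<Rightarrow> 'b ugraph \<Rightarrow> bool" where
  "contains_induced G H \<longleftrightarrow> (\<exists>X\<subseteq>verts G. isomorphic H (induced G X))"

definition path_graph :: "nat \<Rightarrow> nat ugraph" where
  "path_graph k = \<lparr>verts = {..<k}, edges = {{i, Suc i} | i. Suc i < k}\<rparr>"

definition disjoint_union :: "'a ugraph \<Rightarrow> 'b ugraph \<Rightarrow> ('a + 'b) ugraph" where
  "disjoint_union G H =
     \<lparr>verts = verts G <+> verts H,
      edges = (`) Inl ` edges G \<union> (`) Inr ` edges H\<rparr>"

text \<open>The vertices \<open>x\<^sub>1, x\<^sub>2, x\<^sub>3, y, z\<close> of the bull are \<open>1, 2, 3, 4, 5\<close>.\<close>

definition bull :: "nat ugraph" where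
  "bull = \<lparr>verts = {1, 2, 3, 4, 5},
           edges = {{1, 2}, {1, 3}, {2, 3}, {1, 4}, {2, 5}}\<rparr>"

definition clique_number :: "'a ugraph \<Rightarrow> nat" where
  "clique_number G = Max {card K | K. K \<subseteq> verts G \<and> clique K (edges G)}"

definition colourable :: "'a ugraph \<Rightarrow> nat \<Rightarrow> bool" where
  "colourable G k \<longleftrightarrow>
     (\<exists>c \<in> verts G \<rightarrow> {..<k}. \<forall>u v. {u, v} \<in> edges G \<longrightarrow> c u \<noteq> c v)"

definition chromatic_number :: "'a ugraph \<Rightarrow> nat" where
  "chromatic_number G = (LEAST k. colourable G k)"

definition complete_to :: "'a ugraph \<Rightarrow> 'a set \<Rightarrow> 'a set \<Rightarrow> bool" where
  "complete_to G A B \<longleftrightarrow> (\<forall>a\<in>A. \<forall>b\<in>B. {a, b} \<in> edges G)"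

definition anticomplete_to :: "'a ugraph \<Rightarrow> 'a set \<Rightarrow> 'a set \<Rightarrow> bool" where
  "anticomplete_to G A B \<longleftrightarrow> (\<forall>a\<in>A. \<forall>b\<in>B. {a, b} \<notin> edges G)"

definition homogeneous_set :: "'a ugraph \<Rightarrow> 'a set \<Rightarrow> bool" where
  "homogeneous_set G X \<longleftrightarrow>
     X \<subseteq> verts G \<and> 1 < card X \<and> card X < card (verts G) \<and>
     (\<forall>v \<in> verts G - X. complete_to G {v} X \<or> anticomplete_to G {v} X)"

definition perfect :: "'a ugraph \<Rightarrow> bool" where
  "perfect G \<longleftrightarrow>
     (\<forall>X\<subseteq>verts G. chromatic_number (induced G X) = clique_number (induced G X))"

definition has_perfect_division :: "'a ugraph \<Rightarrow> bool" where
  "has_perfect_division G \<longleftrightarrow>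
     (\<exists>A B. A \<union> B = verts G \<and> A \<inter> B = {} \<and>
        perfect (induced G A) \<and> clique_number (induced G B) < clique_number G)"

end

theory Submission
  imports Defs
begin

text \<open>Take a vertex \<open>v\<close> of a triangle \<open>v, p, q\<close>; the division is \<open>A\<close> = the vertices not adjacent
  to \<open>v\<close>, \<open>B\<close> = the neighbours of \<open>v\<close>. If \<open>A\<close> is not perfect, it contains a minimal imperfect
  \<open>H\<close>, which has no homogeneous set, no star cutset, and no stable set meeting all its largest
  cliques. The strong perfect graph theorem is not needed.

  If \<open>G\<close> has no homogeneous set, then by bull-freeness no neighbour \<open>u\<close> of \<open>v\<close> is complete to \<open>H\<close>,
  and the neighbourhood \<open>N u\<close> of \<open>u\<close> in \<open>H\<close> is stable; since \<open>uv\<close> is an edge, \<open>H - N u\<close> is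
  \<open>P\<^sub>4\<close>-free, that is, a cograph. For adjacent neighbours \<open>p, q\<close> of \<open>v\<close> the sets \<open>N p\<close>, \<open>N q\<close> are
  equal or disjoint and complete to each other, and the second case gives a star cutset or a
  dominated vertex in \<open>H\<close>. Hence \<open>N\<close> takes a single value \<open>Z\<close> on the component of \<open>p, q\<close> among the
  neighbours of \<open>v\<close>. This component is not homogeneous, and a vertex mixed on it must be complete to
  \<open>H - Z\<close> and anticomplete to \<open>Z\<close>. This forces a nested structure between \<open>Z\<close> and \<open>H - Z\<close>, which
  yields a stable set meeting all largest cliques of \<open>H\<close>.\<close>

subsection \<open>Modules, cographs and bulls\<close>

locale graph_relation =
  fixes adj :: "'a \<Rightarrow> 'a \<Rightarrow> bool" (infix "\<sim>" 50)
  assumes adj_sym: "x \<sim> y \<Longrightarrow> y \<sim> x"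
    and adj_irrefl: "\<not> x \<sim> x"
begin

definition stable :: "'a set \<Rightarrow> bool" where
  "stable S \<longleftrightarrow> (\<forall>x\<in>S. \<forall>y\<in>S. \<not> x \<sim> y)"

definition cliq :: "'a set \<Rightarrow> bool" where
  "cliq S \<longleftrightarrow> (\<forall>x\<in>S. \<forall>y\<in>S. x \<noteq> y \<longrightarrow> x \<sim> y)"

text \<open>Cuts replace paths, so that complementation exchanges \<open>conn\<close> and
  \<open>coconn\<close>. The empty set and singletons count as connected.\<close>

definition conn :: "'a set \<Rightarrow> bool" where
  "conn S \<longleftrightarrow> (\<forall>A\<subseteq>S. A \<noteq> {} \<longrightarrow> A \<noteq> S \<longrightarrow> (\<exists>x\<in>A. \<exists>y\<in>S - A. x \<sim> y))"

definition coconn :: "'a set \<Rightarrow> bool" where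
  "coconn S \<longleftrightarrow> (\<forall>A\<subseteq>S. A \<noteq> {} \<longrightarrow> A \<noteq> S \<longrightarrow> (\<exists>x\<in>A. \<exists>y\<in>S - A. \<not> x \<sim> y))"

text \<open>The empty set, singletons and \<open>S\<close> itself are modules; homogeneous sets are
  the modules with at least two vertices that are not the whole vertex set.\<close>

definition is_module :: "'a set \<Rightarrow> 'a set \<Rightarrow> bool" where
  "is_module X S \<longleftrightarrow> X \<subseteq> S \<and> (\<forall>y\<in>S - X. \<forall>x\<in>X. \<forall>x'\<in>X. y \<sim> x \<longrightarrow> y \<sim> x')"

text \<open>Primality in the sense of modular decomposition.\<close>

definition indecomposable :: "'a set \<Rightarrow> bool" where
  "indecomposable S \<longleftrightarrow> (\<forall>X. is_module X S \<longrightarrow> X \<noteq> S \<longrightarrow> (\<forall>x\<in>X. \<forall>y\<in>X. x = y))"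

definition split_graph :: "'a set \<Rightarrow> bool" where
  "split_graph S \<longleftrightarrow> (\<exists>Z\<subseteq>S. stable Z \<and> cliq (S - Z))"

definition P4_free :: "'a set \<Rightarrow> bool" where
  "P4_free S \<longleftrightarrow> (\<forall>a\<in>S. \<forall>b\<in>S. \<forall>c\<in>S. \<forall>d\<in>S.
     a \<sim> b \<longrightarrow> b \<sim> c \<longrightarrow> c \<sim> d \<longrightarrow> \<not> a \<sim> c \<longrightarrow> \<not> b \<sim> d \<longrightarrow> a \<sim> d)"

text \<open>No distinctness conditions are needed here and in \<open>P4_free\<close>: the (non)adjacencies force it.\<close>

definition bull_free :: "'a set \<Rightarrow> bool" where
  "bull_free S \<longleftrightarrow> (\<forall>x1\<in>S. \<forall>x2\<in>S. \<forall>x3\<in>S. \<forall>y\<in>S. \<forall>z\<in>S.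
     x1 \<sim> x2 \<longrightarrow> x1 \<sim> x3 \<longrightarrow> x2 \<sim> x3 \<longrightarrow> x1 \<sim> y \<longrightarrow> x2 \<sim> z \<longrightarrow>
     \<not> y \<sim> x2 \<longrightarrow> \<not> y \<sim> x3 \<longrightarrow> \<not> z \<sim> x1 \<longrightarrow> \<not> z \<sim> x3 \<longrightarrow> y \<sim> z)"

lemma adj_commute: "x \<sim> y \<longleftrightarrow> y \<sim> x"
  using adj_sym by blast

lemma bull_freeD:
  assumes "bull_free S" "x1 \<in> S" "x2 \<in> S" "x3 \<in> S" "y \<in> S" "z \<in> S"
    "x1 \<sim> x2" "x1 \<sim> x3" "x2 \<sim> x3" "x1 \<sim> y" "x2 \<sim> z"
    "\<not> y \<sim> x2" "\<not> y \<sim> x3" "\<not> z \<sim> x1" "\<not> z \<sim> x3"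
  shows "y \<sim> z"
  using assms unfolding bull_free_def by blast

lemma P4_freeD:
  assumes "P4_free S" "a \<in> S" "b \<in> S" "c \<in> S" "d \<in> S"
    "a \<sim> b" "b \<sim> c" "c \<sim> d" "\<not> a \<sim> c" "\<not> b \<sim> d"
  shows "a \<sim> d"
  using assms unfolding P4_free_def by blast

lemma P4_free_subset: "P4_free S \<Longrightarrow> T \<subseteq> S \<Longrightarrow> P4_free T"
  unfolding P4_free_def by blast

lemma connE:
  assumes "conn S" "A \<subseteq> S" "A \<noteq> {}" "A \<noteq> S"
  obtains x y where "x \<in> A" "y \<in> S - A" "x \<sim> y"
  using assms unfolding conn_def by blast

lemma coconnE:
  assumes "coconn S" "A \<subseteq> S" "A \<noteq> {}" "A \<noteq> S"
  obtains x y where "x \<in> A" "y \<in> S - A" "\<not> x \<sim> y"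
  using assms unfolding coconn_def by blast

text \<open>Typically \<open>P\<close> is adjacency to a vertex that is mixed on \<open>S\<close>;
  the result is an edge of \<open>S\<close> whose ends this vertex distinguishes.\<close>

lemma conn_mixed:
  assumes "conn S" "x \<in> S" "P x" "y \<in> S" "\<not> P y"
  obtains a b where "a \<in> S" "b \<in> S" "a \<sim> b" "P a" "\<not> P b"
proof -
  have "{a \<in> S. P a} \<subseteq> S" "{a \<in> S. P a} \<noteq> {}" "{a \<in> S. P a} \<noteq> S"
    using assms by auto
  from connE[OF assms(1) this] obtain a b
    where "a \<in> {a \<in> S. P a}" "b \<in> S - {a \<in> S. P a}" "a \<sim> b" by metis
  thus thesis using that by blast
qed

lemma coconn_mixed:
  assumes "coconn S" "x \<in> S" "P x" "y \<in> S" "\<not> P y"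
  obtains a b where "a \<in> S" "b \<in> S" "\<not> a \<sim> b" "P a" "\<not> P b"
proof -
  have "{a \<in> S. P a} \<subseteq> S" "{a \<in> S. P a} \<noteq> {}" "{a \<in> S. P a} \<noteq> S"
    using assms by auto
  from coconnE[OF assms(1) this] obtain a b
    where "a \<in> {a \<in> S. P a}" "b \<in> S - {a \<in> S. P a}" "\<not> a \<sim> b" by metis
  thus thesis using that by blast
qed

lemma component_exists:
  assumes "x \<in> S"
  obtains D where "x \<in> D" "D \<subseteq> S" "conn D" "\<And>d e. d \<in> D \<Longrightarrow> e \<in> S - D \<Longrightarrow> \<not> d \<sim> e"
proof -
  define closed where "closed D \<longleftrightarrow> x \<in> D \<and> D \<subseteq> S \<and> (\<forall>d\<in>D. \<forall>e\<in>S - D. \<not> d \<sim> e)" for D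
  \<comment> \<open>The component is the least set that contains \<open>x\<close> and has no edge to
    the rest of \<open>S\<close>; a cut of it without edges would leave a smaller such set.\<close>
  define D where "D = \<Inter> (Collect closed)"
  have "closed S" using assms unfolding closed_def by blast
  hence D: "closed D"
    unfolding D_def closed_def by blast
  have least: "D \<subseteq> E" if "closed E" for E
    using that unfolding D_def by blast
  have "conn D"
    unfolding conn_def
  proof (intro allI impI, rule ccontr)
    fix A assume A: "A \<subseteq> D" "A \<noteq> {}" "A \<noteq> D"
      and no: "\<not> (\<exists>x\<in>A. \<exists>y\<in>D - A. x \<sim> y)"
    show False
    proof (cases "x \<in> A")
      case True
      have "closed A" using D True A no unfolding closed_def by blast
      thus False using least A by blast
    next
      case False
      have "closed (D - A)"
        using D False A no adj_sym unfolding closed_def by blast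
      thus False using least[of "D - A"] A by blast
    qed
  qed
  thus thesis using that[of D] D unfolding closed_def by blast
qed

section \<open>The complement graph\<close>

lemma complement: "graph_relation (\<lambda>x y. x \<noteq> y \<and> \<not> x \<sim> y)"
  by unfold_locales (auto simp: adj_commute)

text \<open>Modules are the same in the complement, split graphs are closed under complementation,
  and the P4 and the bull are self-complementary. Hence each lemma of the locale also yields its
  dual.\<close>

lemma co_defs:
  shows "graph_relation.conn (\<lambda>x y. x \<noteq> y \<and> \<not> x \<sim> y) S \<longleftrightarrow> coconn S"
    and "graph_relation.coconn (\<lambda>x y. x \<noteq> y \<and> \<not> x \<sim> y) S \<longleftrightarrow> conn S"
    and "graph_relation.stable (\<lambda>x y. x \<noteq> y \<and> \<not> x \<sim> y) S \<longleftrightarrow> cliq S"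
    and "graph_relation.cliq (\<lambda>x y. x \<noteq> y \<and> \<not> x \<sim> y) S \<longleftrightarrow> stable S"
    and "graph_relation.is_module (\<lambda>x y. x \<noteq> y \<and> \<not> x \<sim> y) X S \<longleftrightarrow> is_module X S"
    and "graph_relation.indecomposable (\<lambda>x y. x \<noteq> y \<and> \<not> x \<sim> y) S \<longleftrightarrow> indecomposable S"
    and "graph_relation.split_graph (\<lambda>x y. x \<noteq> y \<and> \<not> x \<sim> y) S \<longleftrightarrow> split_graph S"
    and "graph_relation.P4_free (\<lambda>x y. x \<noteq> y \<and> \<not> x \<sim> y) S \<longleftrightarrow> P4_free S"
    and "graph_relation.bull_free (\<lambda>x y. x \<noteq> y \<and> \<not> x \<sim> y) S \<longleftrightarrow> bull_free S"
proof -
  interpret co: graph_relation "\<lambda>x y. x \<noteq> y \<and> \<not> x \<sim> y" by (rule complement)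
  have "(\<exists>x\<in>A. \<exists>y\<in>S - A. x \<noteq> y \<and> \<not> x \<sim> y) \<longleftrightarrow> (\<exists>x\<in>A. \<exists>y\<in>S - A. \<not> x \<sim> y)" for A
    by (intro bex_cong refl) auto
  thus "co.conn S \<longleftrightarrow> coconn S" unfolding co.conn_def coconn_def by simp
  have "(\<exists>x\<in>A. \<exists>y\<in>S - A. \<not> (x \<noteq> y \<and> \<not> x \<sim> y)) \<longleftrightarrow> (\<exists>x\<in>A. \<exists>y\<in>S - A. x \<sim> y)" for A
    by (intro bex_cong refl) auto
  thus "co.coconn S \<longleftrightarrow> conn S" unfolding co.coconn_def conn_def by simp
  show stable: "co.stable S \<longleftrightarrow> cliq S" for S unfolding co.stable_def cliq_def by blast
  show cliq: "co.cliq S \<longleftrightarrow> stable S" for S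
    unfolding co.cliq_def stable_def by (intro ball_cong refl) (use adj_irrefl in auto)
  show mod: "co.is_module X S \<longleftrightarrow> is_module X S" for X
  proof -
    have "(y \<noteq> x \<and> \<not> y \<sim> x \<longrightarrow> y \<noteq> x' \<and> \<not> y \<sim> x') \<longleftrightarrow> (y \<sim> x' \<longrightarrow> y \<sim> x)"
      if "y \<in> S - X" "x \<in> X" "x' \<in> X" for x x' y
      using that by auto
    thus ?thesis unfolding co.is_module_def is_module_def by (metis (no_types))
  qed
  show "co.indecomposable S \<longleftrightarrow> indecomposable S"
    unfolding co.indecomposable_def indecomposable_def mod ..
  have "(\<exists>Z\<subseteq>S. cliq Z \<and> stable (S - Z)) \<longleftrightarrow> (\<exists>Z\<subseteq>S. stable Z \<and> cliq (S - Z))"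
  proof -
    have "S - (S - Z) = Z" if "Z \<subseteq> S" for Z using that by blast
    thus ?thesis by (metis Diff_subset)
  qed
  thus "co.split_graph S \<longleftrightarrow> split_graph S"
    unfolding co.split_graph_def split_graph_def cliq stable .
  show "co.P4_free S \<longleftrightarrow> P4_free S"
  proof
    assume *: "co.P4_free S"
    show "P4_free S" unfolding P4_free_def
    proof (intro ballI impI, rule ccontr)
      fix a b c d assume "a\<in>S" "b\<in>S" "c\<in>S" "d\<in>S" "a \<sim> b" "b \<sim> c" "c \<sim> d" "\<not> a \<sim> c" "\<not> b \<sim> d" "\<not> a \<sim> d"
      moreover from this have "a \<noteq> c" "b \<noteq> d" "a \<noteq> d" using adj_commute by blast+
      \<comment> \<open>The complement of the path \<open>a\<close>, \<open>b\<close>,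
        \<open>c\<close>, \<open>d\<close> is the path \<open>b\<close>, \<open>d\<close>,
        \<open>a\<close>, \<open>c\<close>.\<close>
      moreover have "b \<noteq> c \<and> \<not> b \<sim> c"
        by (rule co.P4_freeD[OF *, of b d a c]) (use calculation in \<open>auto simp: adj_commute\<close>)
      ultimately show False by blast
    qed
  next
    assume *: "P4_free S"
    show "co.P4_free S" unfolding co.P4_free_def
    proof (intro ballI impI, rule ccontr)
      fix a b c d assume "a\<in>S" "b\<in>S" "c\<in>S" "d\<in>S" "a \<noteq> b \<and> \<not> a \<sim> b" "b \<noteq> c \<and> \<not> b \<sim> c"
        "c \<noteq> d \<and> \<not> c \<sim> d" "\<not> (a \<noteq> c \<and> \<not> a \<sim> c)" "\<not> (b \<noteq> d \<and> \<not> b \<sim> d)" "\<not> (a \<noteq> d \<and> \<not> a \<sim> d)"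
      moreover from this have "a \<noteq> c" "b \<noteq> d" "a \<noteq> d" using adj_commute by blast+
      moreover have "b \<sim> c"
        by (rule P4_freeD[OF *, of b d a c]) (use calculation in \<open>auto simp: adj_commute\<close>)
      ultimately show False by blast
    qed
  qed
  show "co.bull_free S \<longleftrightarrow> bull_free S"
  proof
    assume *: "co.bull_free S"
    show "bull_free S" unfolding bull_free_def
    proof (intro ballI impI, rule ccontr)
      fix x1 x2 x3 y z assume A: "x1 \<in> S" "x2 \<in> S" "x3 \<in> S" "y \<in> S" "z \<in> S"
        "x1 \<sim> x2" "x1 \<sim> x3" "x2 \<sim> x3" "x1 \<sim> y" "x2 \<sim> z"
        "\<not> y \<sim> x2" "\<not> y \<sim> x3" "\<not> z \<sim> x1" "\<not> z \<sim> x3" "\<not> y \<sim> z"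
      have ne: "y \<noteq> x2" "z \<noteq> x1" "z \<noteq> y" "y \<noteq> x3" "z \<noteq> x3"
        using A adj_commute by blast+
      \<comment> \<open>In the complement of a bull the triangle is \<open>y\<close>,
        \<open>z\<close>, \<open>x3\<close>, with \<open>x2\<close> pendant at \<open>y\<close> and
        \<open>x1\<close> pendant at \<open>z\<close>.\<close>
      have "x2 \<noteq> x1 \<and> \<not> x2 \<sim> x1"
        by (rule co.bull_freeD[OF *, of y z x3 x2 x1]) (use A ne in \<open>auto simp: adj_commute\<close>)
      thus False using A adj_commute by blast
    qed
  next
    assume *: "bull_free S"
    show "co.bull_free S" unfolding co.bull_free_def
    proof (intro ballI impI, rule ccontr)
      let ?a = "\<lambda>x y. x \<noteq> y \<and> \<not> x \<sim> y"
      fix x1 x2 x3 y z assume A: "x1 \<in> S" "x2 \<in> S" "x3 \<in> S" "y \<in> S" "z \<in> S"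
        "?a x1 x2" "?a x1 x3" "?a x2 x3" "?a x1 y" "?a x2 z"
        "\<not> ?a y x2" "\<not> ?a y x3" "\<not> ?a z x1" "\<not> ?a z x3" "\<not> ?a y z"
      have ne: "y \<noteq> x2" "z \<noteq> x1" "z \<noteq> y" "y \<noteq> x3" "z \<noteq> x3"
        using A adj_commute by blast+
      have "x2 \<sim> x1"
        by (rule bull_freeD[OF *, of y z x3 x2 x1]) (use A ne in \<open>auto simp: adj_commute\<close>)
      thus False using A adj_commute by blast
    qed
  qed
qed

text \<open>Connectivity gives an edge from some \<open>d'\<close> in \<open>D\<close> that misses
  \<open>x\<close> to a neighbour \<open>d\<close> of \<open>x\<close> in \<open>D\<close>, and a
  neighbour \<open>e\<close> of \<open>x\<close> outside \<open>D\<close>; then \<open>d'\<close>,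
  \<open>d\<close>, \<open>x\<close>, \<open>e\<close> induce a P4. This is the inductive step for
  cographs.\<close>

lemma P4_free_extend:
  assumes "P4_free S" and x: "x \<in> S" and conn: "conn S"
    and D: "D \<subseteq> S - {x}" "D \<noteq> {}" "D \<noteq> S - {x}"
    and anti: "\<And>d e. d \<in> D \<Longrightarrow> e \<in> S - {x} - D \<Longrightarrow> \<not> d \<sim> e"
    and y: "y \<in> D" "\<not> y \<sim> x"
  shows False
proof -
  let ?Y = "{d \<in> D. \<not> d \<sim> x}"
  obtain d' d where d: "d' \<in> ?Y" "d \<in> S - ?Y" "d' \<sim> d"
    using connE[OF conn, of ?Y] y D x by blast
  have d1: "d \<in> D" "d \<sim> x" using d anti by blast+
  let ?E = "S - {x} - D"
  obtain e f where e: "e \<in> ?E" "f \<in> S - ?E" "e \<sim> f"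
    using connE[OF conn, of ?E] D x by blast
  have "f = x" using e anti adj_sym by blast
  thus False
    using P4_freeD[OF assms(1), of d' d x e] d d1 e anti adj_commute x D by blast
qed

end

text \<open>Seinsche's theorem on cographs.\<close>

lemma (in graph_relation) P4_free_cases:
  assumes "finite S" "P4_free S" "x \<in> S" "y \<in> S" "x \<noteq> y"
  shows "\<not> conn S \<or> \<not> coconn S"
  using assms
proof (induction "card S" arbitrary: S x y rule: less_induct)
  case less
  interpret co: graph_relation "\<lambda>x y. x \<noteq> y \<and> \<not> x \<sim> y" by (rule complement)
  let ?T = "S - {x}"
  show ?case
  proof (rule ccontr)
    assume "\<not> ?thesis"
    hence c: "conn S" "coconn S" by auto
    show False
    proof (cases "?T = {y}")
      case True
      obtain a b where "a \<in> {x}" "b \<in> S - {x}" "a \<sim> b"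
        using connE[OF c(1), of "{x}"] less.prems by blast
      moreover obtain a' b' where "a' \<in> {x}" "b' \<in> S - {x}" "\<not> a' \<sim> b'"
        using coconnE[OF c(2), of "{x}"] less.prems by blast
      ultimately show False using True by auto
    next
      case False
      then obtain y' where y': "y' \<in> ?T" "y' \<noteq> y" using less.prems by blast
      have "\<not> conn ?T \<or> \<not> coconn ?T"
        using less.hyps[of ?T y y'] less.prems y' P4_free_subset[of S ?T]
        by (metis Diff_iff Diff_subset card_Diff1_less finite_Diff singletonD)
      thus False
      proof
        assume "\<not> conn ?T"
        then obtain A where A: "A \<subseteq> ?T" "A \<noteq> {}" "A \<noteq> ?T" "\<And>d e. d \<in> A \<Longrightarrow> e \<in> ?T - A \<Longrightarrow> \<not> d \<sim> e"
          unfolding conn_def by blast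
        \<comment> \<open>As \<open>S\<close> is co-connected, \<open>x\<close> has a non-neighbour;
          \<open>P4_free_extend\<close> applies to the side of the cut that contains it.\<close>
        obtain z where z: "z \<in> ?T" "\<not> z \<sim> x"
          using coconnE[OF c(2), of "{x}"] less.prems adj_commute by blast
        show False
        proof (cases "z \<in> A")
          case True
          thus False using P4_free_extend[OF less.prems(2,3) c(1) A(1-3) A(4)] z by blast
        next
          case False
          have "\<not> d \<sim> e" if "d \<in> ?T - A" "e \<in> ?T - (?T - A)" for d e
            using that A adj_commute by blast
          thus False using P4_free_extend[OF less.prems(2,3) c(1), of "?T - A" z] z A False by blast
        qed
      next
        assume "\<not> coconn ?T"
        then obtain A where A: "A \<subseteq> ?T" "A \<noteq> {}" "A \<noteq> ?T" "\<And>d e. d \<in> A \<Longrightarrow> e \<in> ?T - A \<Longrightarrow> d \<sim> e"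
          unfolding coconn_def by blast
        have prems: "co.P4_free S" "co.conn S" using less.prems(2) c(2) co_defs by auto
        obtain z where z: "z \<in> ?T" "z \<sim> x"
          using connE[OF c(1), of "{x}"] less.prems adj_commute by blast
        show False
        proof (cases "z \<in> A")
          case True
          thus False using co.P4_free_extend[OF prems(1) less.prems(3) prems(2) A(1-3), of z] A(4) z by blast
        next
          case False
          have "d \<sim> e" if "d \<in> ?T - A" "e \<in> ?T - (?T - A)" for d e
            using that A adj_commute by blast
          thus False using co.P4_free_extend[OF prems(1) less.prems(3) prems(2), of "?T - A" z] z A False by blast
        qed
      qed
    qed
  qed
qed

section \<open>Parts of indecomposable sets\<close>

context graph_relation
begin

text \<open>A component of \<open>N\<close> with an edge would be a proper module: the rest of
  \<open>N\<close> is anticomplete to it, and \<open>closed\<close>, followed along its edges, makes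
  each vertex of \<open>H - N\<close> complete or anticomplete to it.\<close>

lemma indecomposable_part_stable:
  assumes "indecomposable H" "N \<subseteq> H" "N \<noteq> H"
    and closed: "\<And>d d' r. d \<in> N \<Longrightarrow> d' \<in> N \<Longrightarrow> d \<sim> d' \<Longrightarrow> r \<in> H - N \<Longrightarrow> r \<sim> d \<Longrightarrow> r \<sim> d'"
  shows "stable N"
  unfolding stable_def
proof (intro ballI notI)
  fix x y assume xy: "x \<in> N" "y \<in> N" "x \<sim> y"
  obtain D where D: "x \<in> D" "D \<subseteq> N" "conn D" "\<And>d e. d \<in> D \<Longrightarrow> e \<in> N - D \<Longrightarrow> \<not> d \<sim> e"
    using component_exists[OF xy(1)] by metis
  have "is_module D H"
    unfolding is_module_def
  proof (intro conjI ballI impI)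
    fix r a b assume r: "r \<in> H - D" "a \<in> D" "b \<in> D" "r \<sim> a"
    show "r \<sim> b"
    proof (rule ccontr)
      assume nb: "\<not> r \<sim> b"
      have "r \<in> H - N" using r D adj_commute by blast
      moreover obtain d d' where "d \<in> D" "d' \<in> D" "d \<sim> d'" "r \<sim> d" "\<not> r \<sim> d'"
        using conn_mixed[OF D(3), of a "\<lambda>d. r \<sim> d" b] r nb by blast
      ultimately show False using closed D by blast
    qed
  qed (use D assms in auto)
  moreover have "D \<noteq> H" using D assms(2,3) by blast
  moreover have "y \<in> D" using D xy by blast
  ultimately have "x = y" using assms(1) D(1) unfolding indecomposable_def by metis
  thus False using xy adj_irrefl by blast
qed

text \<open>The dual of \<open>indecomposable_part_stable\<close>; its hypothesis appears in
  contrapositive form with \<open>d\<close> and \<open>d'\<close> exchanged.\<close>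

lemma indecomposable_part_cliq:
  assumes "indecomposable H" "N \<subseteq> H" "N \<noteq> H"
    and "\<And>d d' r. d \<in> N \<Longrightarrow> d' \<in> N \<Longrightarrow> d \<noteq> d' \<Longrightarrow> \<not> d \<sim> d' \<Longrightarrow> r \<in> H - N \<Longrightarrow> r \<sim> d \<Longrightarrow> r \<sim> d'"
  shows "cliq N"
proof -
  interpret co: graph_relation "\<lambda>x y. x \<noteq> y \<and> \<not> x \<sim> y" by (rule complement)
  have "co.stable N"
  proof (rule co.indecomposable_part_stable[of H])
    fix d d' r assume "d \<in> N" "d' \<in> N" "d \<noteq> d' \<and> \<not> d \<sim> d'" "r \<in> H - N" "r \<noteq> d \<and> \<not> r \<sim> d"
    thus "r \<noteq> d' \<and> \<not> r \<sim> d'" using assms(4)[of d' d r] adj_commute by blast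
  qed (use assms co_defs in auto)
  thus ?thesis using co_defs by simp
qed

text \<open>Otherwise \<open>{x}\<close> and \<open>H - {x}\<close> would form a split
  partition.\<close>

lemma not_split_pair:
  assumes "\<not> split_graph H" "x \<in> H"
  obtains y z where "y \<in> H" "z \<in> H" "x \<noteq> y" "x \<noteq> z" "y \<noteq> z"
proof -
  have "stable {x}" using adj_irrefl by (auto simp: stable_def)
  hence "\<not> cliq (H - {x})" using assms unfolding split_graph_def by blast
  thus thesis using that unfolding cliq_def by blast
qed

text \<open>Both sides of a cut without edges are modules, hence singletons, but a set that is not
  split has at least three vertices.\<close>

lemma indecomposable_conn:
  assumes "indecomposable H" "\<not> split_graph H"
  shows "conn H"
  unfolding conn_def
proof (intro allI impI, rule ccontr)
  fix A assume A: "A \<subseteq> H" "A \<noteq> {}" "A \<noteq> H" and no: "\<not> (\<exists>x\<in>A. \<exists>y\<in>H - A. x \<sim> y)"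
  have "is_module A H" "is_module (H - A) H"
    using A no adj_commute unfolding is_module_def by blast+
  hence *: "\<forall>x\<in>A. \<forall>y\<in>A. x = y" "\<forall>x\<in>H-A. \<forall>y\<in>H-A. x = y"
    using assms(1) A unfolding indecomposable_def by blast+
  obtain x where x: "x \<in> A" using A by blast
  obtain y z where "y \<in> H" "z \<in> H" "x \<noteq> y" "x \<noteq> z" "y \<noteq> z"
    using not_split_pair[OF assms(2), of x] x A by blast
  thus False using * x by blast
qed

lemma indecomposable_coconn:
  assumes "indecomposable H" "\<not> split_graph H"
  shows "coconn H"
proof -
  interpret co: graph_relation "\<lambda>x y. x \<noteq> y \<and> \<not> x \<sim> y" by (rule complement)
  show ?thesis using co.indecomposable_conn[of H] assms co_defs by auto
qed

text \<open>A vertex adjacent to \<open>a\<close> but not to \<open>c\<close> would split \<open>H\<close> into a stable set and a clique.\<close>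

lemma mixed_adj_centre:
  assumes bf: "bull_free V" and H: "H \<subseteq> V" "indecomposable H" "\<not> split_graph H"
    and c: "c \<in> V" "\<And>h. h \<in> H \<Longrightarrow> c \<sim> h"
    and a: "a \<in> V" "\<And>h. h \<in> H \<Longrightarrow> \<not> a \<sim> h"
    and ca: "c \<sim> a"
    and r: "r \<in> V" "r \<notin> H" "x \<in> H" "r \<sim> x" "y \<in> H" "\<not> r \<sim> y"
  shows "r \<sim> c"
proof (rule ccontr)
  assume nrc: "\<not> r \<sim> c"
  have conn: "conn H" using H indecomposable_conn by blast
  show False
  proof (cases "r \<sim> a")
    case False
    \<comment> \<open>The bull has triangle \<open>c\<close>, \<open>d\<close>, \<open>e\<close>,
      with \<open>a\<close> pendant at \<open>c\<close> and \<open>r\<close> pendant at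
      \<open>d\<close>.\<close>
    obtain d e where "d \<in> H" "e \<in> H" "d \<sim> e" "r \<sim> d" "\<not> r \<sim> e"
      using conn_mixed[OF conn, of x "\<lambda>d. r \<sim> d" y] r by blast
    thus False using bull_freeD[OF bf, of c d e a r] H c a ca r nrc False adj_commute by blast
  next
    case True
    let ?Z = "{h \<in> H. r \<sim> h}"
    \<comment> \<open>Forbidden bull: triangle \<open>r\<close>, \<open>d\<close>,
      \<open>d'\<close>, with \<open>a\<close> pendant at \<open>r\<close> and \<open>s\<close>
      pendant at \<open>d\<close>.\<close>
    have "stable ?Z"
    proof (rule indecomposable_part_stable[OF H(2)])
      fix d d' s assume "d \<in> ?Z" "d' \<in> ?Z" "d \<sim> d'" "s \<in> H - ?Z" "s \<sim> d"
      thus "s \<sim> d'" using bull_freeD[OF bf, of r d d' a s] H c a r True adj_commute by blast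
    qed (use r in auto)
    \<comment> \<open>Forbidden bull: triangle \<open>c\<close>, \<open>s\<close>, \<open>d\<close>,
      with \<open>d'\<close> pendant at \<open>c\<close> and \<open>r\<close> pendant at
      \<open>s\<close>.\<close>
    moreover have "cliq (H - ?Z)"
    proof (rule indecomposable_part_cliq[OF H(2)])
      fix d d' s assume "d \<in> H - ?Z" "d' \<in> H - ?Z" "d \<noteq> d'" "\<not> d \<sim> d'" "s \<in> H - (H - ?Z)" "s \<sim> d"
      thus "s \<sim> d'" using bull_freeD[OF bf, of c s d d' r] H c a r nrc adj_commute by blast
    qed (use r in auto)
    ultimately have "?Z \<subseteq> H \<and> stable ?Z \<and> cliq (H - ?Z)" by simp
    thus False using H(3) unfolding split_graph_def by metis
  qed
qed

text \<open>The dual of \<open>mixed_adj_centre\<close>: complementation exchanges the centre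
  \<open>c\<close> with the anticentre \<open>a\<close>.\<close>

lemma mixed_not_adj_anticentre:
  assumes bf: "bull_free V" and H: "H \<subseteq> V" "indecomposable H" "\<not> split_graph H"
    and c: "c \<in> V" "c \<notin> H" "\<And>h. h \<in> H \<Longrightarrow> c \<sim> h"
    and a: "a \<in> V" "a \<notin> H" "\<And>h. h \<in> H \<Longrightarrow> \<not> a \<sim> h"
    and ca: "\<not> c \<sim> a"
    and r: "r \<in> V" "r \<notin> H" "x \<in> H" "r \<sim> x" "y \<in> H" "\<not> r \<sim> y"
  shows "\<not> r \<sim> a"
proof -
  interpret co: graph_relation "\<lambda>x y. x \<noteq> y \<and> \<not> x \<sim> y" by (rule complement)
  have "r \<noteq> a \<and> \<not> r \<sim> a"
  proof (rule co.mixed_adj_centre[of V H a c r y x])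
    show "a \<noteq> c \<and> \<not> a \<sim> c" using c a r ca adj_commute by blast
  qed (use assms co_defs in auto)
  thus ?thesis by blast
qed

text \<open>With \<open>A\<close> the anticentres, \<open>C\<close> the centres and \<open>R\<close>
  the mixed vertices, the set \<open>X\<close> is a module that misses \<open>a\<close>: it is
  anticomplete to \<open>A\<close>, and the centres outside it are complete to it.\<close>

lemma centre_anticentre_aux:
  assumes bf: "bull_free V" and V: "indecomposable V"
    and H: "H \<subseteq> V" "indecomposable H" "\<not> split_graph H"
    and a: "a \<in> V" "a \<notin> H" "\<And>h. h \<in> H \<Longrightarrow> \<not> a \<sim> h"
    and anti: "\<And>r b x y. r \<in> V - H \<Longrightarrow> x \<in> H \<Longrightarrow> r \<sim> x \<Longrightarrow> y \<in> H \<Longrightarrow> \<not> r \<sim> y \<Longrightarrow>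
       b \<in> V - H \<Longrightarrow> (\<And>h. h \<in> H \<Longrightarrow> \<not> b \<sim> h) \<Longrightarrow> \<not> r \<sim> b"
  shows False
proof -
  define A where "A = {b \<in> V - H. \<forall>h\<in>H. \<not> b \<sim> h}"
  define C where "C = {c \<in> V - H. \<forall>h\<in>H. c \<sim> h}"
  define R where "R = V - H - A - C"
  define T where "T = {c \<in> C. \<forall>b\<in>A. \<not> c \<sim> b}"
  define T0 where "T0 = {t \<in> T. \<forall>s\<in>C - T. t \<sim> s}"
  define X where "X = H \<union> R \<union> T0"
  have R: "\<exists>x\<in>H. \<exists>y\<in>H. r \<sim> x \<and> \<not> r \<sim> y" if "r \<in> R" for r
    using that unfolding R_def A_def C_def by blast
  have RA: "\<not> r \<sim> b" if "r \<in> R" "b \<in> A" for r b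
    using R[OF that(1)] anti[of r _ _ b] that unfolding R_def A_def by blast
  have SR: "r \<sim> s" if s: "s \<in> C - T" and r: "r \<in> R" for r s
  proof -
    obtain b where b: "b \<in> A" "s \<sim> b" using s unfolding T_def by blast
    obtain x y where xy: "x \<in> H" "y \<in> H" "r \<sim> x" "\<not> r \<sim> y" using R r by blast
    show ?thesis
      using mixed_adj_centre[OF bf H, of s b r x y] xy b s r unfolding A_def C_def R_def by blast
  qed
  have "is_module X V"
    unfolding is_module_def
  proof (intro conjI ballI impI)
    show "X \<subseteq> V" using H unfolding X_def R_def T0_def T_def C_def by blast
    fix w x y assume w: "w \<in> V - X" and xy: "x \<in> X" "y \<in> X" "w \<sim> x"
    have "w \<in> A \<or> w \<in> C - T \<or> w \<in> T - T0"
      using w unfolding X_def R_def T0_def T_def by blast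
    then consider "w \<in> A" | "w \<in> C - T" | "w \<in> T - T0" by blast
    thus "w \<sim> y"
    proof cases
      case 1
      have "\<not> w \<sim> x"
        using xy(1) 1 RA adj_commute unfolding X_def T0_def T_def A_def by blast
      thus ?thesis using xy by blast
    next
      case 2
      thus ?thesis using xy SR adj_commute unfolding X_def T0_def C_def by blast
    next
      case 3
      \<comment> \<open>If \<open>w\<close> missed a vertex \<open>y\<close> of \<open>R\<close> or
        \<open>T0\<close>, there would be a bull with triangle \<open>s\<close>, \<open>h\<close>,
        \<open>y\<close>, with \<open>b\<close> pendant at \<open>s\<close> and \<open>w\<close>
        pendant at \<open>h\<close>.\<close>
      then obtain s where s: "s \<in> C - T" "\<not> w \<sim> s" unfolding T0_def by blast
      then obtain b where b: "b \<in> A" "s \<sim> b" unfolding T_def by blast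
      have wC: "w \<in> C" using 3 unfolding T_def by blast
      show ?thesis
      proof (cases "y \<in> H")
        case True
        thus ?thesis using wC unfolding C_def by blast
      next
        case False
        hence y: "y \<in> R \<or> y \<in> T0" using xy X_def by blast
        have ys: "y \<sim> s" using y SR[OF s(1)] s unfolding T0_def by blast
        obtain h where h: "h \<in> H" "y \<sim> h"
        proof (cases "y \<in> R")
          case True
          thus thesis using that R by blast
        next
          case False
          hence "y \<in> C" using y unfolding T0_def T_def by blast
          moreover obtain h where "h \<in> H"
            using H(3) unfolding split_graph_def stable_def cliq_def by blast
          ultimately show thesis using that unfolding C_def by blast
        qed
        have yb: "\<not> b \<sim> y" using y RA b adj_commute unfolding T0_def T_def by blast
        have wb: "\<not> b \<sim> w" using 3 b adj_commute unfolding T_def by blast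
        have mem: "s \<in> V" "h \<in> V" "y \<in> V" "b \<in> V" "w \<in> V" "s \<sim> h" "\<not> b \<sim> h" "w \<sim> h"
          using s h y b wC H unfolding C_def A_def R_def T0_def T_def by blast+
        show ?thesis
        proof (rule ccontr)
          assume "\<not> w \<sim> y"
          thus False
            using bull_freeD[OF bf, of s h y b w] mem yb wb s(2) b ys h adj_commute by blast
        qed
      qed
    qed
  qed
  moreover obtain h where h: "h \<in> H"
    using H(3) unfolding split_graph_def stable_def cliq_def by blast
  moreover obtain h' where "h' \<in> H" "h \<noteq> h'" using not_split_pair[OF H(3) h] by blast
  moreover have "a \<notin> X"
    using a h unfolding X_def R_def T0_def T_def C_def A_def by blast
  ultimately show False using V a(1) unfolding indecomposable_def X_def by blast
qed

text \<open>Vertices mixed on \<open>H\<close> are either all anticomplete to the anticentres of \<open>H\<close> or all complete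
  to its centres; the two cases are exchanged by complementation.\<close>

lemma no_centre_and_anticentre:
  assumes bf: "bull_free V" and V: "indecomposable V"
    and H: "H \<subseteq> V" "indecomposable H" "\<not> split_graph H"
    and c: "c \<in> V" "c \<notin> H" "\<And>h. h \<in> H \<Longrightarrow> c \<sim> h"
    and a: "a \<in> V" "a \<notin> H" "\<And>h. h \<in> H \<Longrightarrow> \<not> a \<sim> h"
  shows False
proof (cases "\<exists>r b x y. r \<in> V - H \<and> x \<in> H \<and> r \<sim> x \<and> y \<in> H \<and> \<not> r \<sim> y \<and>
       b \<in> V - H \<and> (\<forall>h\<in>H. \<not> b \<sim> h) \<and> r \<sim> b")
  case False
  show False
    by (rule centre_anticentre_aux[OF bf V H a]) (use False in blast)+
next
  case True
  then obtain r b x y where r: "r \<in> V - H" "x \<in> H" "r \<sim> x" "y \<in> H" "\<not> r \<sim> y"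
    and b: "b \<in> V - H" "\<forall>h\<in>H. \<not> b \<sim> h" "r \<sim> b" by blast
  interpret co: graph_relation "\<lambda>x y. x \<noteq> y \<and> \<not> x \<sim> y" by (rule complement)
  show False
  proof (rule co.centre_anticentre_aux[where V = V and H = H and a = c])
    fix r' c' x' y'
    assume r': "r' \<in> V - H" "x' \<in> H" "r' \<noteq> x' \<and> \<not> r' \<sim> x'" "y' \<in> H" "\<not> (r' \<noteq> y' \<and> \<not> r' \<sim> y')"
      and c': "c' \<in> V - H" "\<And>h. h \<in> H \<Longrightarrow> \<not> (c' \<noteq> h \<and> \<not> c' \<sim> h)"
    have c'H: "c' \<sim> h" if "h \<in> H" for h using c' that by blast
    \<comment> \<open>The anticentre \<open>b\<close> has a mixed neighbour, so it is adjacent to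
      each centre \<open>c'\<close>; this edge in turn makes each mixed \<open>r'\<close> adjacent
      to \<open>c'\<close>.\<close>
    have "c' \<sim> b"
      using mixed_not_adj_anticentre[OF bf H, of c' b r x y] c' c'H r b by blast
    hence "r' \<sim> c'"
      using mixed_adj_centre[OF bf H, of c' b r' y' x'] c' c'H r' b by blast
    thus "\<not> (r' \<noteq> c' \<and> \<not> r' \<sim> c')" by blast
  next
    show "co.bull_free V" "co.indecomposable V" "co.indecomposable H" "\<not> co.split_graph H"
      unfolding co_defs using bf V H by simp_all
    show "\<not> (c \<noteq> h \<and> \<not> c \<sim> h)" if "h \<in> H" for h using c(3) that by simp
  qed (use H c in simp_all)
qed

end

subsection \<open>Minimal imperfect graphs\<close>

context graph_relation
begin

section \<open>Clique number and colourability\<close>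

definition om :: "'a set \<Rightarrow> nat" where
  "om S = Max {card K | K. K \<subseteq> S \<and> cliq K}"

definition col :: "'a set \<Rightarrow> nat \<Rightarrow> bool" where
  "col S k \<longleftrightarrow> (\<exists>c. (\<forall>x\<in>S. c x < k) \<and> (\<forall>x\<in>S. \<forall>y\<in>S. x \<sim> y \<longrightarrow> c x \<noteq> c y))"

text \<open>As every colouring needs at least \<open>om\<close> colours, this says \<chi> > \<omega>
  for \<open>H\<close> and \<chi> = \<omega> for its proper parts.\<close>

definition minimal_imperfect :: "'a set \<Rightarrow> bool" where
  "minimal_imperfect H \<longleftrightarrow> finite H \<and> \<not> col H (om H) \<and> (\<forall>S. S \<subset> H \<longrightarrow> col S (om S))"

lemma finite_clique_sizes: "finite S \<Longrightarrow> finite {card K | K. K \<subseteq> S \<and> cliq K}"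
  by (rule finite_subset[of _ "card ` Pow S"]) auto

lemma om_ge: "finite S \<Longrightarrow> K \<subseteq> S \<Longrightarrow> cliq K \<Longrightarrow> card K \<le> om S"
  unfolding om_def by (intro Max_ge finite_clique_sizes) auto

lemma om_attained:
  assumes "finite S"
  obtains K where "K \<subseteq> S" "cliq K" "card K = om S"
proof -
  have "cliq {}" by (simp add: cliq_def)
  hence "{card K | K. K \<subseteq> S \<and> cliq K} \<noteq> {}" by blast
  from Max_in[OF finite_clique_sizes[OF assms] this]
  obtain K where "om S = card K" "K \<subseteq> S" "cliq K" unfolding om_def by blast
  thus thesis using that[of K] by simp
qed

lemma om_mono: "finite T \<Longrightarrow> S \<subseteq> T \<Longrightarrow> om S \<le> om T"
  by (metis om_attained om_ge finite_subset subset_trans)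

lemma cliq_subset: "cliq K \<Longrightarrow> L \<subseteq> K \<Longrightarrow> cliq L"
  unfolding cliq_def by blast

lemma cliq_insert: "cliq K \<Longrightarrow> (\<And>x. x \<in> K \<Longrightarrow> x \<noteq> y \<Longrightarrow> x \<sim> y) \<Longrightarrow> cliq (insert y K)"
  unfolding cliq_def using adj_sym by blast

text \<open>Otherwise \<open>insert y K\<close> would be a larger clique. Used to contradict a
  largest clique that avoids a suitable stable set.\<close>

lemma om_maximal:
  assumes "finite S" "K \<subseteq> S" "cliq K" "card K = om S" "y \<in> S" "\<And>x. x \<in> K \<Longrightarrow> x \<noteq> y \<Longrightarrow> x \<sim> y"
  shows "y \<in> K"
proof (rule ccontr)
  assume "y \<notin> K"
  moreover have "card (insert y K) \<le> om S"
    using assms by (intro om_ge cliq_insert) auto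
  ultimately show False using assms finite_subset[of K S] by simp
qed

lemma col_mono: "col S k \<Longrightarrow> k \<le> l \<Longrightarrow> col S l"
  unfolding col_def by (meson less_le_trans)

section \<open>Stable sets, star cutsets and domination\<close>

lemma minimal_imperfect_nonempty: "minimal_imperfect H \<Longrightarrow> H \<noteq> {}"
  unfolding minimal_imperfect_def col_def by auto

text \<open>If \<open>T\<close> met all largest cliques, then \<open>H - T\<close> would have a
  smaller clique number, and an optimal colouring of it with one new colour for \<open>T\<close>
  would colour \<open>H\<close> with \<open>om H\<close> colours.\<close>

lemma minimal_imperfect_avoid_stable:
  assumes H: "minimal_imperfect H" and T: "T \<subseteq> H" "stable T"
  obtains K where "K \<subseteq> H" "cliq K" "card K = om H" "K \<inter> T = {}"
proof -
  have "\<exists>K\<subseteq>H. cliq K \<and> card K = om H \<and> K \<inter> T = {}"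
  proof (rule ccontr)
    assume "\<not> ?thesis"
    hence hits: "K \<inter> T \<noteq> {}" if "K \<subseteq> H" "cliq K" "card K = om H" for K
      using that by blast
    have fin: "finite H" using H minimal_imperfect_def by blast
    obtain K0 where "K0 \<subseteq> H" "cliq K0" "card K0 = om H" using om_attained[OF fin] by blast
    hence "T \<noteq> {}" using hits by blast
    hence sub: "H - T \<subset> H" using T by blast
    have le: "om (H - T) \<le> om H" using om_mono[OF fin] by blast
    obtain K where K: "K \<subseteq> H - T" "cliq K" "card K = om (H - T)"
      using om_attained[of "H - T"] fin by blast
    hence "om (H - T) \<noteq> om H" using hits[of K] by auto
    hence lt: "om (H - T) < om H" using le by simp
    obtain c where c: "\<forall>x\<in>H - T. c x < om (H - T)" "\<forall>x\<in>H - T. \<forall>y\<in>H - T. x \<sim> y \<longrightarrow> c x \<noteq> c y"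
      using H sub unfolding minimal_imperfect_def col_def by blast
    have c1: "c x < om (H - T)" if "x \<in> H" "x \<notin> T" for x using c(1) that by blast
    define d where "d x = (if x \<in> T then om (H - T) else c x)" for x
    have "d x < om H" if "x \<in> H" for x
      using c1[of x] lt that unfolding d_def by (cases "x \<in> T") simp_all
    moreover have "d x \<noteq> d y" if xy: "x \<in> H" "y \<in> H" "x \<sim> y" for x y
    proof -
      have "\<not> (x \<in> T \<and> y \<in> T)" using T xy unfolding stable_def by blast
      moreover have "c x \<noteq> c y" if "x \<notin> T" "y \<notin> T" using xy c(2) that by blast
      ultimately show ?thesis using c1[of x] c1[of y] xy unfolding d_def
        by (cases "x \<in> T"; cases "y \<in> T") simp_all
    qed
    ultimately have "col H (om H)" unfolding col_def by blast
    thus False using H minimal_imperfect_def by blast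
  qed
  thus thesis using that by blast
qed

text \<open>Chvatal's star cutset lemma. Colour \<open>H - B\<close> and \<open>H - A\<close> with
  \<open>om H\<close> colours each. The two colour classes of \<open>y\<close> have a stable union,
  as on the cutset only \<open>y\<close> has its colour. A largest clique lies on one side and uses
  all colours there, so it meets this union.\<close>

lemma minimal_imperfect_no_star_cutset:
  assumes H: "minimal_imperfect H" and y: "y \<in> H" and A: "A \<subseteq> H" "B \<subseteq> H" "A \<noteq> {}" "B \<noteq> {}" "A \<inter> B = {}"
    and anti: "\<And>a b. a \<in> A \<Longrightarrow> b \<in> B \<Longrightarrow> \<not> a \<sim> b"
    and yAB: "y \<notin> A" "y \<notin> B"
    and star: "\<And>z. z \<in> H \<Longrightarrow> z \<notin> A \<Longrightarrow> z \<notin> B \<Longrightarrow> z = y \<or> z \<sim> y"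
  shows False
proof -
  have fin: "finite H" using H minimal_imperfect_def by blast
  have sub: "H - B \<subset> H" "H - A \<subset> H" using A by blast+
  have "col (H - B) (om H)" "col (H - A) (om H)"
    using H sub col_mono om_mono[OF fin] unfolding minimal_imperfect_def by (meson Diff_subset)+
  then obtain f g where f: "\<forall>x\<in>H - B. f x < om H" "\<forall>x\<in>H - B. \<forall>y\<in>H - B. x \<sim> y \<longrightarrow> f x \<noteq> f y"
    and g: "\<forall>x\<in>H - A. g x < om H" "\<forall>x\<in>H - A. \<forall>y\<in>H - A. x \<sim> y \<longrightarrow> g x \<noteq> g y"
    unfolding col_def by blast
  define T where "T = {x \<in> H - B. f x = f y} \<union> {x \<in> H - A. g x = g y}"
  have T_sub: "x = y \<or> (x \<in> A \<and> f x = f y) \<or> (x \<in> B \<and> g x = g y)" if "x \<in> T" for x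
    using that star[of x] f(2) g(2) y yAB unfolding T_def by blast
  have "stable T"
    unfolding stable_def
  proof (intro ballI notI)
    fix a b assume ab: "a \<in> T" "b \<in> T" "a \<sim> b"
    have "f a \<noteq> f b" if "a \<in> H - B" "b \<in> H - B" using f that ab by blast
    moreover have "g a \<noteq> g b" if "a \<in> H - A" "b \<in> H - A" using g that ab by blast
    ultimately show False
      using T_sub[OF ab(1)] T_sub[OF ab(2)] ab anti y yAB A adj_irrefl adj_commute by (smt (verit) Diff_iff disjoint_iff subset_iff)
  qed
  moreover have "T \<subseteq> H" unfolding T_def by blast
  ultimately obtain K where K: "K \<subseteq> H" "cliq K" "card K = om H" "K \<inter> T = {}"
    using minimal_imperfect_avoid_stable[OF H] by metis
  have hit: "\<exists>x\<in>K. c x = c y"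
    if "K \<subseteq> S" "y \<in> S" and c: "\<forall>x\<in>S. c x < om H" "\<forall>x\<in>S. \<forall>y\<in>S. x \<sim> y \<longrightarrow> c x \<noteq> c y" for S and c :: "'a \<Rightarrow> nat"
  proof -
    have "inj_on c K"
    proof (rule inj_onI, rule ccontr)
      fix a b assume "a \<in> K" "b \<in> K" "c a = c b" "a \<noteq> b"
      thus False using c(2) \<open>K \<subseteq> S\<close> K(2) unfolding cliq_def by blast
    qed
    hence "card (c ` K) = card {..<om H}" using K by (simp add: card_image)
    moreover have "c ` K \<subseteq> {..<om H}" using c that by blast
    ultimately have "c ` K = {..<om H}" by (intro card_subset_eq) auto
    thus ?thesis using c that by (metis imageE lessThan_iff)
  qed
  have "K \<subseteq> H - B \<or> K \<subseteq> H - A"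
  proof (rule ccontr)
    assume "\<not> ?thesis"
    then obtain a b where ab: "a \<in> K" "a \<in> A" "b \<in> K" "b \<in> B" using K(1) by blast
    moreover have "a \<noteq> b" using ab A by blast
    ultimately show False using K(2) anti unfolding cliq_def by blast
  qed
  thus False
  proof
    assume "K \<subseteq> H - B"
    moreover from this obtain x where "x \<in> K" "f x = f y" using hit[of "H - B" f] f y yAB by blast
    ultimately show False using K(4) unfolding T_def by blast
  next
    assume "K \<subseteq> H - A"
    moreover from this obtain x where "x \<in> K" "g x = g y" using hit[of "H - A" g] g y yAB by blast
    ultimately show False using K(4) unfolding T_def by blast
  qed
qed

text \<open>If \<open>x\<close> is the only possible non-neighbour of \<open>y\<close>, then
  \<open>y\<close> and its non-neighbours form a stable set that meets every largest clique.
  Otherwise \<open>y\<close> with its neighbours other than \<open>x\<close> is a star cutset that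
  separates \<open>x\<close> from the other non-neighbours of \<open>y\<close>.\<close>

lemma minimal_imperfect_not_dominated:
  assumes H: "minimal_imperfect H" and xy: "x \<in> H" "y \<in> H" "x \<noteq> y"
    and dom: "\<And>z. z \<in> H \<Longrightarrow> z \<sim> x \<Longrightarrow> z = y \<or> z \<sim> y"
  shows False
proof -
  have fin: "finite H" using H minimal_imperfect_def by blast
  define M where "M = {z \<in> H. z \<noteq> y \<and> \<not> z \<sim> y}"
  show False
  proof (cases "M \<subseteq> {x}")
    case True
    have "stable (insert y M)"
      using True adj_irrefl adj_commute unfolding M_def stable_def by blast
    moreover have "insert y M \<subseteq> H" using xy unfolding M_def by blast
    ultimately obtain K where K: "K \<subseteq> H" "cliq K" "card K = om H" "K \<inter> insert y M = {}"
      using minimal_imperfect_avoid_stable[OF H] by metis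
    have "y \<in> K"
      using om_maximal[OF fin K(1-3) xy(2)] K unfolding M_def by blast
    thus False using K by blast
  next
    case False
    show False
    proof (rule minimal_imperfect_no_star_cutset[OF H xy(2), of "{x}" "M - {x}"])
      show "\<not> a \<sim> b" if "a \<in> {x}" "b \<in> M - {x}" for a b
        using that dom[of b] adj_commute unfolding M_def by blast
    qed (use False xy in \<open>auto simp: M_def\<close>)
  qed
qed

text \<open>A module \<open>X\<close> that is not a clique can be replaced by a largest clique of it; this is a
  proper part of \<open>H\<close> with the same clique number, and an optimal colouring of \<open>X\<close> can be
  transplanted into one of that part.\<close>

lemma minimal_imperfect_indecomposable:
  assumes H: "minimal_imperfect H"
  shows "indecomposable H"
  unfolding indecomposable_def
proof (intro allI impI ballI, rule ccontr)
  fix X x x' assume X: "is_module X H" "X \<noteq> H" and x: "x \<in> X" "x' \<in> X" "x \<noteq> x'"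
  have fin: "finite H" using H minimal_imperfect_def by blast
  have XH: "X \<subset> H" using X unfolding is_module_def by blast
  have fX: "finite X" using fin XH finite_subset by blast
  show False
  proof (cases "cliq X")
    \<comment> \<open>Two vertices of a clique module dominate each other.\<close>
    case True
    show False
    proof (rule minimal_imperfect_not_dominated[OF H, of x x'])
      fix z assume "z \<in> H" "z \<sim> x"
      thus "z = x' \<or> z \<sim> x'"
        using True X x unfolding is_module_def cliq_def by blast
    qed (use x XH in auto)
  next
    case False
    obtain K where K: "K \<subseteq> X" "cliq K" "card K = om X" using om_attained[OF fX] by blast
    have "K \<noteq> X" using False K by blast
    define H' where "H' = (H - X) \<union> K"
    have H': "H' \<subset> H" using K XH \<open>K \<noteq> X\<close> unfolding H'_def by blast
    have "col H' (om H)"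
      using H H' col_mono om_mono[OF fin] unfolding minimal_imperfect_def by (meson psubset_imp_subset)
    then obtain f where f: "\<forall>x\<in>H'. f x < om H" "\<forall>x\<in>H'. \<forall>y\<in>H'. x \<sim> y \<longrightarrow> f x \<noteq> f y"
      unfolding col_def by blast
    obtain g where g: "\<forall>x\<in>X. g x < om X" "\<forall>x\<in>X. \<forall>y\<in>X. x \<sim> y \<longrightarrow> g x \<noteq> g y"
      using H XH unfolding minimal_imperfect_def col_def by blast
    have "inj_on f K"
    proof (rule inj_onI, rule ccontr)
      fix a b assume "a \<in> K" "b \<in> K" "f a = f b" "a \<noteq> b"
      thus False using f(2) K(2) unfolding cliq_def H'_def by blast
    qed
    hence "card (f ` K) = card {..<om X}" using K by (simp add: card_image)
    moreover have "finite (f ` K)" using K fX finite_subset by blast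
    \<comment> \<open>\<open>e\<close> renames the \<open>om X\<close> colours of \<open>g\<close>
      to the colours that \<open>f\<close> gives to \<open>K\<close>.\<close>
    ultimately obtain e where e: "bij_betw e {..<om X} (f ` K)"
      using finite_same_card_bij[of "{..<om X}" "f ` K"] by auto
    define h where "h z = (if z \<in> X then e (g z) else f z)" for z
    have hX: "h z \<in> f ` K" if "z \<in> X" for z
      using that e g unfolding h_def bij_betw_def by auto
    \<comment> \<open>A vertex outside \<open>X\<close> with a neighbour in \<open>X\<close> is
      adjacent to all of \<open>K\<close>, so \<open>f\<close> gives it none of the colours of
      \<open>K\<close>.\<close>
    have fK: "f y \<notin> f ` K" if y: "y \<in> H - X" and z: "z \<in> X" "y \<sim> z" for y z
    proof
      assume "f y \<in> f ` K"
      then obtain k where k: "k \<in> K" "f y = f k" by blast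
      have "y \<sim> k" using X y z k K unfolding is_module_def by blast
      thus False using f(2) k y unfolding H'_def by blast
    qed
    have "h z < om H" if "z \<in> H" for z
    proof (cases "z \<in> X")
      case True
      thus ?thesis using hX[OF True] f(1) unfolding H'_def by auto
    next
      case False
      thus ?thesis using f(1) that unfolding h_def H'_def by auto
    qed
    moreover have "h z \<noteq> h w" if zw: "z \<in> H" "w \<in> H" "z \<sim> w" for z w
    proof -
      consider "z \<in> X" "w \<in> X" | "z \<in> X" "w \<notin> X" | "z \<notin> X" "w \<in> X" | "z \<notin> X" "w \<notin> X" by blast
      thus ?thesis
      proof cases
        case 1
        hence "g z \<noteq> g w" using g zw by blast
        moreover have "g z \<in> {..<om X}" "g w \<in> {..<om X}" using g 1 by auto
        ultimately show ?thesis
          using e 1 unfolding h_def bij_betw_def by (auto dest: inj_onD)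
      next
        case 2
        thus ?thesis using fK[of w z] hX[of z] zw adj_commute unfolding h_def by auto
      next
        case 3
        thus ?thesis using fK[of z w] hX[of w] zw unfolding h_def by auto
      next
        case 4
        thus ?thesis using f(2) zw unfolding h_def H'_def by auto
      qed
    qed
    ultimately have "col H (om H)" unfolding col_def by blast
    thus False using H minimal_imperfect_def by blast
  qed
qed

text \<open>A largest clique avoiding \<open>Z\<close> must be \<open>H - Z\<close>. For
  \<open>y\<close> in it, \<open>y\<close> and its non-neighbours in \<open>Z\<close> form a stable
  set; a largest clique avoiding this set is complete to \<open>y\<close> and so could be
  enlarged.\<close>

lemma minimal_imperfect_not_split:
  assumes H: "minimal_imperfect H"
  shows "\<not> split_graph H"
proof
  assume "split_graph H"
  then obtain Z where Z: "Z \<subseteq> H" "stable Z" "cliq (H - Z)" unfolding split_graph_def by blast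
  have fin: "finite H" using H minimal_imperfect_def by blast
  obtain K where K: "K \<subseteq> H" "cliq K" "card K = om H" "K \<inter> Z = {}"
    using minimal_imperfect_avoid_stable[OF H Z(1,2)] by blast
  have "H - Z \<subseteq> K"
  proof
    fix y assume "y \<in> H - Z"
    thus "y \<in> K"
      using om_maximal[OF fin K(1-3), of y] K Z unfolding cliq_def by blast
  qed
  hence KZ: "K = H - Z" using K by blast
  have "K \<noteq> {}"
  proof
    assume "K = {}"
    moreover obtain x where "x \<in> H" using minimal_imperfect_nonempty[OF H] by blast
    moreover have "card {x} \<le> om H" using \<open>x \<in> H\<close> om_ge[OF fin, of "{x}"] by (simp add: cliq_def)
    ultimately show False using K by simp
  qed
  then obtain y where y: "y \<in> K" by blast
  define T where "T = insert y {z \<in> Z. \<not> z \<sim> y}"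
  have "stable T" using Z adj_irrefl adj_commute unfolding T_def stable_def by blast
  moreover have "T \<subseteq> H" using y K Z unfolding T_def by blast
  ultimately obtain L where L: "L \<subseteq> H" "cliq L" "card L = om H" "L \<inter> T = {}"
    using minimal_imperfect_avoid_stable[OF H] by metis
  have "x \<sim> y" if "x \<in> L" for x
    using that L y K KZ unfolding T_def cliq_def by blast
  hence "y \<in> L" using om_maximal[OF fin L(1-3), of y] y K by blast
  thus False using L unfolding T_def by blast
qed

lemma imperfect_obtains_minimal:
  assumes "finite S" "\<not> col S (om S)"
  obtains H where "H \<subseteq> S" "minimal_imperfect H"
proof -
  have "\<exists>H\<subseteq>S. minimal_imperfect H"
    using assms
  proof (induction S rule: finite_psubset_induct)
    case (psubset S)
    show ?case
    proof (cases "\<forall>T. T \<subset> S \<longrightarrow> col T (om T)")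
      case True
      thus ?thesis using psubset unfolding minimal_imperfect_def by blast
    next
      case False
      then obtain T where "T \<subset> S" "\<not> col T (om T)" by blast
      thus ?thesis using psubset.IH[of T] by blast
    qed
  qed
  thus thesis using that by blast
qed

end

subsection \<open>Stable sets with a cograph complement\<close>

context graph_relation
begin

text \<open>The P4 is sought among the vertices anticomplete to an edge; \<open>e\<close> and
  \<open>f\<close> are not among them, being adjacent to each other.\<close>

definition P2_P4_free :: "'a set \<Rightarrow> bool" where
  "P2_P4_free S \<longleftrightarrow> (\<forall>e\<in>S. \<forall>f\<in>S. e \<sim> f \<longrightarrow> P4_free {x \<in> S. \<not> e \<sim> x \<and> \<not> f \<sim> x})"

text \<open>An edge of \<open>Q\<close> inside the neighbourhood of \<open>z\<close> is not
  distinguished by a vertex of \<open>Q\<close> outside that neighbourhood.\<close>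

definition edge_closed :: "'a set \<Rightarrow> 'a set \<Rightarrow> bool" where
  "edge_closed Z Q \<longleftrightarrow> (\<forall>z\<in>Z. \<forall>d\<in>Q. \<forall>d'\<in>Q. \<forall>r\<in>Q.
     z \<sim> d \<longrightarrow> z \<sim> d' \<longrightarrow> d \<sim> d' \<longrightarrow> r \<sim> d \<longrightarrow> z \<sim> r \<or> r \<sim> d')"

text \<open>The ends of an edge of \<open>Q\<close> have neighbourhoods in \<open>Z\<close> that are
  comparable by inclusion.\<close>

definition edge_nested :: "'a set \<Rightarrow> 'a set \<Rightarrow> bool" where
  "edge_nested Z Q \<longleftrightarrow> (\<forall>d\<in>Q. \<forall>d'\<in>Q. \<forall>z\<in>Z. \<forall>z'\<in>Z.
     d \<sim> d' \<longrightarrow> z \<sim> d \<longrightarrow> z' \<sim> d' \<longrightarrow> z \<sim> d' \<or> z' \<sim> d)"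

lemma edge_closedD:
  assumes "edge_closed Z Q" "z \<in> Z" "d \<in> Q" "d' \<in> Q" "r \<in> Q"
    "z \<sim> d" "z \<sim> d'" "d \<sim> d'" "r \<sim> d" "\<not> z \<sim> r"
  shows "r \<sim> d'"
  using assms unfolding edge_closed_def by blast

lemma edge_nestedD:
  assumes "edge_nested Z Q" "d \<in> Q" "d' \<in> Q" "z \<in> Z" "z' \<in> Z"
    "d \<sim> d'" "z \<sim> d" "z' \<sim> d'"
  shows "z \<sim> d' \<or> z' \<sim> d"
  using assms unfolding edge_nested_def by blast

text \<open>Otherwise the cograph \<open>H - A\<close> has at least two vertices and is disconnected
  or a join. In the first case \<open>b\<close> and \<open>A\<close> form a star cutset; in the
  second, a vertex of the side of the join without \<open>b\<close> dominates each vertex of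
  \<open>A\<close>.\<close>

lemma anticomplete_outside:
  assumes H: "minimal_imperfect H" and A: "A \<subseteq> H" "A \<noteq> {}" "stable A"
    and b: "b \<in> H" "b \<notin> A" "\<And>a. a \<in> A \<Longrightarrow> a \<sim> b"
    and P4: "P4_free (H - A)"
    and closed: "edge_closed A (H - A)"
    and x: "x \<in> H - A"
  shows "\<not> b \<sim> x"
proof
  assume bx: "b \<sim> x"
  let ?Q = "H - A"
  have fin: "finite ?Q" using H minimal_imperfect_def by blast
  have "\<not> conn ?Q \<or> \<not> coconn ?Q"
    using P4_free_cases[OF fin P4, of b x] b x bx adj_irrefl by blast
  thus False
  proof
    assume "\<not> conn ?Q"
    then obtain C where C: "C \<subseteq> ?Q" "C \<noteq> {}" "C \<noteq> ?Q" "\<And>c d. c \<in> C \<Longrightarrow> d \<in> ?Q - C \<Longrightarrow> \<not> c \<sim> d"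
      unfolding conn_def by blast
    have cut: False if D: "D \<subseteq> ?Q" "D \<noteq> {}" "D \<noteq> ?Q" "\<And>c d. c \<in> D \<Longrightarrow> d \<in> ?Q - D \<Longrightarrow> \<not> c \<sim> d" and bD: "b \<in> D" for D
    proof (rule minimal_imperfect_no_star_cutset[OF H b(1), of "D - {b}" "?Q - D"])
      have "x \<in> D" using D(4)[of b x] x bx bD by blast
      thus "D - {b} \<noteq> {}" using bx adj_irrefl by blast
      show "z = b \<or> z \<sim> b" if "z \<in> H" "z \<notin> D - {b}" "z \<notin> ?Q - D" for z
        using that b(3) by blast
      show "\<not> c \<sim> d" if "c \<in> D - {b}" "d \<in> ?Q - D" for c d
        using that D(4) by blast
    qed (use D bD in auto)
    show False
    proof (cases "b \<in> C")
      case True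
      thus False using cut[OF C] by blast
    next
      case False
      have "\<not> c \<sim> d" if "c \<in> ?Q - C" "d \<in> ?Q - (?Q - C)" for c d
        using that C adj_commute by blast
      thus False using cut[of "?Q - C"] C False b by blast
    qed
  next
    assume "\<not> coconn ?Q"
    then obtain C where C: "C \<subseteq> ?Q" "C \<noteq> {}" "C \<noteq> ?Q" "\<And>c d. c \<in> C \<Longrightarrow> d \<in> ?Q - C \<Longrightarrow> c \<sim> d"
      unfolding coconn_def by blast
    have join: False if D: "D \<subseteq> ?Q" "D \<noteq> {}" "D \<noteq> ?Q" and compl: "\<And>c d. c \<in> D \<Longrightarrow> d \<in> ?Q - D \<Longrightarrow> c \<sim> d"
      and bD: "b \<notin> D" for D
    proof -
      have bc: "b \<sim> c" "c \<sim> b" if "c \<in> D" for c using compl[OF that] b bD adj_commute by blast+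
      \<comment> \<open>If \<open>r\<close> in \<open>A\<close> saw only \<open>d\<close>,
        closedness for the triangle \<open>r\<close>, \<open>b\<close>, \<open>d\<close> would make
        \<open>d'\<close> adjacent to \<open>d\<close>.\<close>
      have "cliq D"
      proof (rule indecomposable_part_cliq[OF minimal_imperfect_indecomposable[OF H]])
        fix d d' r assume d: "d \<in> D" "d' \<in> D" "d \<noteq> d'" "\<not> d \<sim> d'" and r: "r \<in> H - D" "r \<sim> d"
        show "r \<sim> d'"
        proof (cases "r \<in> A")
          case True
          show ?thesis
          proof (rule ccontr)
            assume "\<not> r \<sim> d'"
            hence "d' \<sim> d"
              using edge_closedD[OF closed, of r b d d'] True b bc d r D by blast
            thus False using d adj_sym by blast
          qed
        next
          case False
          thus ?thesis using compl[of d' r] d r adj_sym by blast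
        qed
      qed (use D b bD in auto)
      obtain j where j: "j \<in> D" using D by blast
      obtain a where a: "a \<in> A" using A by blast
      show False
      proof (rule minimal_imperfect_not_dominated[OF H, of a j])
        fix z assume z: "z \<in> H" "z \<sim> a"
        hence "z \<in> ?Q" using A a unfolding stable_def by blast
        thus "z = j \<or> z \<sim> j"
          using \<open>cliq D\<close> compl[of j z] j adj_sym unfolding cliq_def by blast
      qed (use a j A D in auto)
    qed
    show False
    proof (cases "b \<in> C")
      case False
      thus False using join[OF C] by blast
    next
      case True
      have "c \<sim> d" if "c \<in> ?Q - C" "d \<in> ?Q - (?Q - C)" for c d
        using that C adj_commute by blast
      thus False using join[of "?Q - C"] C True by blast
    qed
  qed
qed

text \<open>By \<open>anticomplete_outside\<close>, applied both ways, no edge leaves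
  \<open>A \<union> B\<close>, so it is all of \<open>H\<close>; then \<open>A\<close> is complete
  to the rest, although \<open>H\<close> is co-connected.\<close>

lemma no_complete_stable_pair:
  assumes H: "minimal_imperfect H" and A: "A \<subseteq> H" "A \<noteq> {}" "stable A" "P4_free (H - A)"
    and B: "B \<subseteq> H" "B \<noteq> {}" "stable B" "P4_free (H - B)"
    and AB: "A \<inter> B = {}" "\<And>a b. a \<in> A \<Longrightarrow> b \<in> B \<Longrightarrow> a \<sim> b"
    and closedA: "edge_closed A (H - A)"
    and closedB: "edge_closed B (H - B)"
  shows False
proof -
  have ind: "indecomposable H" "\<not> split_graph H"
    using H minimal_imperfect_indecomposable minimal_imperfect_not_split by auto
  have 1: "\<not> b \<sim> x" if "b \<in> B" "x \<in> H - A" for b x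
    by (rule anticomplete_outside[OF H A(1-3) _ _ _ A(4) closedA]) (use that AB B in blast)+
  have 2: "\<not> a \<sim> x" if "a \<in> A" "x \<in> H - B" for a x
    by (rule anticomplete_outside[OF H B(1-3) _ _ _ B(4) closedB]) (use that AB A adj_sym in blast)+
  have "A \<union> B = H"
  proof (rule ccontr)
    assume "A \<union> B \<noteq> H"
    then obtain x y where "x \<in> A \<union> B" "y \<in> H - (A \<union> B)" "x \<sim> y"
      using connE[OF indecomposable_conn[OF ind], of "A \<union> B"] A B by blast
    thus False using 1 2 by blast
  qed
  moreover have "A \<noteq> H" using AB B by blast
  ultimately obtain x y where "x \<in> A" "y \<in> H - A" "\<not> x \<sim> y"
    using coconnE[OF indecomposable_coconn[OF ind] A(1,2)] by blast
  thus False using AB \<open>A \<union> B = H\<close> by blast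
qed

text \<open>Let \<open>d\<close> have the most neighbours in \<open>Z\<close>, let \<open>J\<close>
  be its co-component in \<open>D\<close>, and let \<open>X\<close> be the rest. Neighbours in
  \<open>Z\<close> of a vertex of \<open>X\<close> are complete to \<open>J\<close>, and
  \<open>X\<close> turns out to be a single vertex, the root.\<close>

lemma cograph_component_root:
  assumes H: "minimal_imperfect H" and Z: "Z \<subseteq> H"
    and P4: "P4_free (H - Z)"
    and nested: "edge_nested Z (H - Z)"
    and closed: "edge_closed Z (H - Z)"
    and D: "D \<subseteq> H - Z" "conn D" "D \<noteq> {}" "\<And>d e. d \<in> D \<Longrightarrow> e \<in> H - Z - D \<Longrightarrow> \<not> d \<sim> e"
  shows "\<exists>x\<in>D. (\<forall>y\<in>D. y \<noteq> x \<longrightarrow> y \<sim> x) \<and> (\<forall>z\<in>Z. z \<sim> x \<longrightarrow> (\<forall>y\<in>D. z \<sim> y))"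
proof (cases "\<exists>k. D = {k}")
  case True
  thus ?thesis by blast
next
  case False
  have fin: "finite H" using H minimal_imperfect_def by blast
  have finD: "finite D" and finZ: "finite Z" using fin D Z finite_subset by blast+
  let ?f = "\<lambda>y. card {z \<in> Z. z \<sim> y}"
  have "Max (?f ` D) \<in> ?f ` D" using finD D(3) by (intro Max_in) auto
  then obtain d where d: "d \<in> D" "?f d = Max (?f ` D)" by auto
  have dmax: "?f y \<le> ?f d" if "y \<in> D" for y
    unfolding d(2) using that finD by (intro Max_ge) auto
  obtain d' where "d' \<in> D" "d \<noteq> d'" using False d by blast
  hence ncoconn: "\<not> coconn D"
    using P4_free_cases[OF finD P4_free_subset[OF P4 D(1)] d(1)] D(2) by blast
  interpret co: graph_relation "\<lambda>x y. x \<noteq> y \<and> \<not> x \<sim> y" by (rule complement)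
  obtain J where J: "d \<in> J" "J \<subseteq> D" "co.conn J" "\<And>a b. a \<in> J \<Longrightarrow> b \<in> D - J \<Longrightarrow> \<not> (a \<noteq> b \<and> \<not> a \<sim> b)"
    using co.component_exists[OF d(1)] by metis
  have cJ: "coconn J" using J(3) co_defs by simp
  define X where "X = D - J"
  have JX: "a \<sim> b" "b \<sim> a" if "a \<in> J" "b \<in> X" for a b
    using J(4)[of a b] that adj_commute unfolding X_def by blast+
  have "X \<noteq> {}"
  proof
    assume "X = {}"
    hence "J = D" using J(2) unfolding X_def by blast
    thus False using cJ ncoconn by simp
  qed
  have XQ: "X \<subseteq> H - Z" "J \<subseteq> H - Z" using D J unfolding X_def by auto
  \<comment> \<open>Otherwise nestedness along the edge \<open>x d\<close> gives \<open>x\<close>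
    strictly more neighbours in \<open>Z\<close> than \<open>d\<close>.\<close>
  have sub: "z \<sim> d" if x: "x \<in> X" and z: "z \<in> Z" "z \<sim> x" for x z
  proof (rule ccontr)
    assume nz: "\<not> z \<sim> d"
    have "z' \<sim> x" if "z' \<in> Z" "z' \<sim> d" for z'
      using edge_nestedD[OF nested, of x d z z'] JX[OF J(1) x] x z nz that XQ J by blast
    hence "{z \<in> Z. z \<sim> d} \<subset> {z \<in> Z. z \<sim> x}" using z nz by blast
    hence "card {z \<in> Z. z \<sim> d} < card {z \<in> Z. z \<sim> x}" using finZ by (intro psubset_card_mono) auto
    moreover have "x \<in> D" using x X_def by blast
    ultimately show False using dmax[of x] by simp
  qed
  \<comment> \<open>Otherwise \<open>z\<close> distinguishes two non-adjacent vertices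
    \<open>a\<close>, \<open>b\<close> of \<open>J\<close>, against closedness for the triangle
    \<open>z\<close>, \<open>x\<close>, \<open>a\<close>.\<close>
  have full: "z \<sim> j" if x: "x \<in> X" and z: "z \<in> Z" "z \<sim> x" and j: "j \<in> J" for x z j
  proof (rule ccontr)
    assume "\<not> z \<sim> j"
    then obtain a b where ab: "a \<in> J" "b \<in> J" "\<not> a \<sim> b" "z \<sim> a" "\<not> z \<sim> b"
      using coconn_mixed[OF cJ J(1), of "\<lambda>y. z \<sim> y" j] sub[OF x z] j by blast
    have "b \<sim> a" using edge_closedD[OF closed, of z x a b] ab JX x z XQ by blast
    thus False using ab adj_sym by blast
  qed
  have "cliq X"
  proof (rule indecomposable_part_cliq[OF minimal_imperfect_indecomposable[OF H]])
    fix e e' r assume e: "e \<in> X" "e' \<in> X" "e \<noteq> e'" "\<not> e \<sim> e'" and r: "r \<in> H - X" "r \<sim> e"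
    consider "r \<in> Z" | "r \<in> J" | "r \<in> H - Z - D" using r unfolding X_def by blast
    thus "r \<sim> e'"
    proof cases
      case 1
      show ?thesis
      proof (rule ccontr)
        assume "\<not> r \<sim> e'"
        hence "e' \<sim> e"
          using edge_closedD[OF closed, of r d e e'] 1 sub[of e r] e r JX J(1) XQ by blast
        thus False using e adj_sym by blast
      qed
    next
      case 2
      thus ?thesis using JX e by blast
    next
      case 3
      thus ?thesis using D(4)[of e r] e r adj_sym unfolding X_def by blast
    qed
  next
    show "X \<subseteq> H" using XQ by blast
    show "X \<noteq> H" using d J D unfolding X_def by blast
  qed
  have dominated: False if xy: "x \<in> X" "y \<in> X" "x \<noteq> y" "\<And>z. z \<in> Z \<Longrightarrow> z \<sim> x \<Longrightarrow> z \<sim> y" for x y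
  proof (rule minimal_imperfect_not_dominated[OF H _ _ xy(3)])
    fix z assume z: "z \<in> H" "z \<sim> x"
    show "z = y \<or> z \<sim> y"
    proof (cases "z \<in> Z")
      case True
      thus ?thesis using xy z by blast
    next
      case False
      have "z \<in> D" using False D(4)[of x z] xy z adj_sym unfolding X_def by blast
      thus ?thesis using JX[of z y] xy \<open>cliq X\<close> unfolding X_def cliq_def by blast
    qed
  qed (use xy XQ in auto)
  obtain x where x: "x \<in> X" using \<open>X \<noteq> {}\<close> by blast
  \<comment> \<open>As neither dominates the other, each of two vertices of \<open>X\<close> would
    have a neighbour in \<open>Z\<close> that the other lacks, against nestedness.\<close>
  have "y = x" if y: "y \<in> X" for y
  proof (rule ccontr)
    assume "y \<noteq> x"
    obtain z where z: "z \<in> Z" "z \<sim> x" "\<not> z \<sim> y" using dominated[of x y] x y \<open>y \<noteq> x\<close> by blast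
    obtain z' where z': "z' \<in> Z" "z' \<sim> y" "\<not> z' \<sim> x" using dominated[of y x] x y \<open>y \<noteq> x\<close> by blast
    have "x \<sim> y" using \<open>cliq X\<close> x y \<open>y \<noteq> x\<close> unfolding cliq_def by metis
    thus False using edge_nestedD[OF nested, of x y z z'] z z' x y XQ by blast
  qed
  hence DJ: "D = insert x J" using x J unfolding X_def by blast
  show ?thesis
  proof (intro bexI[of _ x] conjI ballI impI)
    show "x \<in> D" using x X_def by blast
    show "y \<sim> x" if "y \<in> D" "y \<noteq> x" for y using that JX x DJ by blast
    show "z \<sim> y" if "z \<in> Z" "z \<sim> x" "y \<in> D" for z y using that full x DJ by blast
  qed
qed

text \<open>The roots of the components of \<open>H - Z\<close> that have no neighbour in \<open>Z\<close> form, together with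
  \<open>Z\<close>, a stable set meeting every largest clique.\<close>

lemma no_nested_stable:
  assumes H: "minimal_imperfect H" and Z: "Z \<subseteq> H" "stable Z"
    and P4: "P4_free (H - Z)"
    and nested: "edge_nested Z (H - Z)"
    and closed: "edge_closed Z (H - Z)"
  shows False
proof -
  have fin: "finite H" using H minimal_imperfect_def by blast
  let ?Q = "H - Z"
  \<comment> \<open>The last condition says that \<open>x\<close> and its neighbours in
    \<open>?Q\<close> form a whole component of \<open>?Q\<close>.\<close>
  define T where "T = {x \<in> ?Q. (\<forall>z\<in>Z. \<not> z \<sim> x) \<and> (\<forall>y\<in>?Q. y \<sim> x \<longrightarrow> (\<forall>w\<in>?Q. w \<sim> y \<longrightarrow> w = x \<or> w \<sim> x))}"
  have T_stable: "\<not> x \<sim> y" if xy: "x \<in> T" "y \<in> T" for x y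
  proof
    assume adj: "x \<sim> y"
    show False
    proof (rule minimal_imperfect_not_dominated[OF H, of y x])
      fix w assume w: "w \<in> H" "w \<sim> y"
      hence "w \<in> ?Q" using xy unfolding T_def by blast
      thus "w = x \<or> w \<sim> x" using xy w adj_sym[OF adj] unfolding T_def by blast
    qed (use xy adj adj_irrefl in \<open>auto simp: T_def\<close>)
  qed
  have "stable (Z \<union> T)"
    unfolding stable_def
  proof (intro ballI)
    fix x y assume xy: "x \<in> Z \<union> T" "y \<in> Z \<union> T"
    have "\<not> z \<sim> t" "\<not> t \<sim> z" if "z \<in> Z" "t \<in> T" for z t
      using that adj_commute unfolding T_def by blast+
    moreover have "\<not> z \<sim> z'" if "z \<in> Z" "z' \<in> Z" for z z'
      using that Z unfolding stable_def by blast
    ultimately show "\<not> x \<sim> y" using xy T_stable by blast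
  qed
  moreover have "Z \<union> T \<subseteq> H" using Z unfolding T_def by blast
  ultimately obtain K where K: "K \<subseteq> H" "cliq K" "card K = om H" "K \<inter> (Z \<union> T) = {}"
    using minimal_imperfect_avoid_stable[OF H] by metis
  have "K \<noteq> {}"
  proof
    assume "K = {}"
    moreover obtain y where "y \<in> H" using minimal_imperfect_nonempty[OF H] by blast
    ultimately show False using om_maximal[OF fin K(1-3), of y] by blast
  qed
  then obtain k where k: "k \<in> K" by blast
  have kQ: "k \<in> ?Q" using k K by blast
  obtain D where D: "k \<in> D" "D \<subseteq> ?Q" "conn D" "\<And>d e. d \<in> D \<Longrightarrow> e \<in> ?Q - D \<Longrightarrow> \<not> d \<sim> e"
    using component_exists[OF kQ] by metis
  have KD: "K \<subseteq> D"
  proof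
    fix y assume y: "y \<in> K"
    show "y \<in> D"
    proof (rule ccontr)
      assume "y \<notin> D"
      hence "y \<noteq> k" "y \<in> ?Q - D" using D y K by blast+
      moreover have "k \<sim> y" using K(2) k y \<open>y \<noteq> k\<close> unfolding cliq_def by metis
      ultimately show False using D(1) D(4)[of k y] by blast
    qed
  qed
  have "D \<noteq> {}" using D by blast
  \<comment> \<open>The root \<open>x\<close> is in \<open>K\<close> by maximality, and a neighbour
    of \<open>x\<close> in \<open>Z\<close> would be complete to \<open>K\<close> and hence in
    \<open>K\<close>. So \<open>x\<close> lies in \<open>T\<close>, which \<open>K\<close>
    avoids.\<close>
  obtain x where x: "x \<in> D" "\<And>y. y \<in> D \<Longrightarrow> y \<noteq> x \<Longrightarrow> y \<sim> x"
    "\<And>z y. z \<in> Z \<Longrightarrow> z \<sim> x \<Longrightarrow> y \<in> D \<Longrightarrow> z \<sim> y"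
    using cograph_component_root[OF H Z(1) P4 nested closed D(2,3) \<open>D \<noteq> {}\<close> D(4)] by blast
  have xH: "x \<in> H" using x D by blast
  have xK: "x \<in> K" using om_maximal[OF fin K(1-3) xH] x(2) KD by blast
  have xZ: "\<not> z \<sim> x" if "z \<in> Z" for z
  proof
    assume zx: "z \<sim> x"
    have "y \<sim> z" if "y \<in> K" for y using x(3)[OF \<open>z \<in> Z\<close> zx] KD that adj_sym by blast
    hence "z \<in> K" using om_maximal[OF fin K(1-3), of z] Z \<open>z \<in> Z\<close> by blast
    thus False using K \<open>z \<in> Z\<close> by blast
  qed
  have "x \<in> T"
    unfolding T_def
  proof (intro CollectI conjI ballI impI)
    show "x \<in> ?Q" using x D by blast
    show "\<not> z \<sim> x" if "z \<in> Z" for z using xZ that .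
    fix y w assume y: "y \<in> ?Q" "y \<sim> x" and w: "w \<in> ?Q" "w \<sim> y"
    have "y \<in> D" using D(4)[of x y] x y adj_sym by blast
    hence "w \<in> D" using D(4)[of y w] w adj_sym by blast
    thus "w = x \<or> w \<sim> x" using x by blast
  qed
  thus False using K xK by blast
qed

end

subsection \<open>The non-neighbours of a vertex in a triangle\<close>

text \<open>A minimal imperfect set \<open>H\<close> of non-neighbours of \<open>v\<close> is fixed;
  the goal is that \<open>v\<close> then lies in no triangle.\<close>

locale imperfect_nonneighbours = graph_relation +
  fixes V H :: "'a set" and v :: 'a
  assumes bull: "bull_free V" and P2P4: "P2_P4_free V" and V: "indecomposable V"
    and H: "minimal_imperfect H" "H \<subseteq> V" and v: "v \<in> V" "\<And>h. h \<in> H \<Longrightarrow> \<not> v \<sim> h"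
begin

section \<open>Neighbourhoods in \<open>H\<close> of the neighbours of \<open>v\<close>\<close>

definition N :: "'a \<Rightarrow> 'a set" where
  "N u = {h \<in> H. u \<sim> h}"

lemma H_prime: "indecomposable H" "\<not> split_graph H" "conn H" "coconn H" "finite H"
  using H(1) minimal_imperfect_indecomposable minimal_imperfect_not_split
    indecomposable_conn indecomposable_coconn minimal_imperfect_def by blast+

lemma v_notin: "v \<notin> H"
proof
  assume "v \<in> H"
  moreover obtain y where "y \<in> H" "v \<noteq> y"
    using not_split_pair[OF H_prime(2)] calculation by metis
  ultimately obtain x y where "x \<in> {v}" "y \<in> H - {v}" "x \<sim> y"
    using connE[OF H_prime(3), of "{v}"] by blast
  thus False using v by blast
qed

lemma nbr_notin: "u \<sim> v \<Longrightarrow> u \<notin> H"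
  using v adj_sym by blast

text \<open>\<open>N u\<close> is not \<open>H\<close>, since \<open>u\<close> would be a centre and
  \<open>v\<close> is an anticentre. An edge \<open>d d'\<close> of \<open>N u\<close> distinguished
  by \<open>r\<close> gives a bull with triangle \<open>u\<close>, \<open>d\<close>,
  \<open>d'\<close> and pendants \<open>v\<close> and \<open>r\<close>.\<close>

lemma stable_N:
  assumes u: "u \<in> V" "u \<sim> v"
  shows "stable (N u)"
proof (rule indecomposable_part_stable[OF H_prime(1)])
  show "N u \<subseteq> H" unfolding N_def by blast
  show "N u \<noteq> H"
  proof
    assume "N u = H"
    hence "u \<sim> h" if "h \<in> H" for h using that unfolding N_def by blast
    thus False
      using no_centre_and_anticentre[OF bull V H(2) H_prime(1,2) u(1) nbr_notin[OF u(2)] _ v(1) v_notin v(2)]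
      by blast
  qed
  fix d d' r assume d: "d \<in> N u" "d' \<in> N u" "d \<sim> d'" and r: "r \<in> H - N u" "r \<sim> d"
  show "r \<sim> d'"
  proof (rule ccontr)
    assume "\<not> r \<sim> d'"
    hence "v \<sim> r"
      using bull_freeD[OF bull, of u d d' v r] d r u v H adj_commute unfolding N_def by blast
    thus False using v r by blast
  qed
qed

lemma P4_free_diff_N:
  assumes u: "u \<in> V" "u \<sim> v"
  shows "P4_free (H - N u)"
proof -
  have "P4_free {x \<in> V. \<not> u \<sim> x \<and> \<not> v \<sim> x}" using P2P4 u v unfolding P2_P4_free_def by blast
  moreover have "H - N u \<subseteq> {x \<in> V. \<not> u \<sim> x \<and> \<not> v \<sim> x}" using H v unfolding N_def by blast
  ultimately show ?thesis by (rule P4_free_subset)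
qed

text \<open>Otherwise \<open>H\<close> would be a cograph, yet it is connected and
  co-connected.\<close>

lemma N_nonempty:
  assumes u: "u \<in> V" "u \<sim> v"
  shows "N u \<noteq> {}"
proof
  assume "N u = {}"
  hence "P4_free H" using P4_free_diff_N[OF u] by simp
  moreover obtain x where "x \<in> H" using minimal_imperfect_nonempty[OF H(1)] by blast
  moreover obtain y where "y \<in> H" "x \<noteq> y" using not_split_pair[OF H_prime(2) \<open>x \<in> H\<close>] by metis
  ultimately show False using P4_free_cases[OF H_prime(5)] H_prime(3,4) by blast
qed

text \<open>A violation is a bull with triangle \<open>z\<close>, \<open>d\<close>,
  \<open>d'\<close>, with \<open>u\<close> pendant at \<open>z\<close> and \<open>r\<close> pendant
  at \<open>d\<close>.\<close>

lemma closed_N: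
  assumes u: "u \<in> V" "u \<sim> v"
  shows "edge_closed (N u) (H - N u)"
  unfolding edge_closed_def
proof (intro ballI impI, rule ccontr)
  fix z d d' r
  assume z: "z \<in> N u" and d: "d \<in> H - N u" "d' \<in> H - N u" "r \<in> H - N u"
    and adj: "z \<sim> d" "z \<sim> d'" "d \<sim> d'" "r \<sim> d" "\<not> (z \<sim> r \<or> r \<sim> d')"
  have "u \<sim> r"
    using bull_freeD[OF bull, of z d d' u r] u z d adj H adj_commute unfolding N_def by blast
  thus False using d unfolding N_def by blast
qed

text \<open>A vertex \<open>h\<close> of \<open>N p\<close> outside \<open>N q\<close> would
  dominate \<open>z\<close>: a neighbour \<open>w\<close> of \<open>z\<close> missing
  \<open>h\<close> gives a bull with triangle \<open>z\<close>, \<open>p\<close>, \<open>q\<close>,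
  with \<open>w\<close> pendant at \<open>z\<close> and \<open>h\<close> pendant at
  \<open>p\<close>.\<close>

lemma N_common_subset:
  assumes p: "p \<in> V" "p \<sim> v" and q: "q \<in> V" "q \<sim> v" and pq: "p \<sim> q"
    and z: "z \<in> N p" "z \<in> N q"
  shows "N p \<subseteq> N q"
proof (rule ccontr)
  assume "\<not> ?thesis"
  then obtain h where h: "h \<in> N p" "h \<notin> N q" by blast
  show False
  proof (rule minimal_imperfect_not_dominated[OF H(1), of z h])
    fix w assume w: "w \<in> H" "w \<sim> z"
    have "\<not> p \<sim> w" "\<not> q \<sim> w"
      using stable_N[OF p] stable_N[OF q] w z unfolding stable_def N_def by blast+
    moreover have "\<not> h \<sim> z" using stable_N[OF p] h z unfolding stable_def by blast
    moreover have "h \<in> V" "w \<in> V" "z \<in> V" "p \<sim> h" "\<not> q \<sim> h" "p \<sim> z" "q \<sim> z"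
      using h w z H unfolding N_def by auto
    ultimately have "w \<sim> h"
      using bull_freeD[OF bull, of z p q w h] p q pq w adj_commute by blast
    thus "w = h \<or> w \<sim> h" by blast
  qed (use h z in \<open>auto simp: N_def\<close>)
qed

text \<open>If the two sets are disjoint, the triangle \<open>p\<close>, \<open>q\<close>,
  \<open>v\<close> with pendants \<open>h\<close> and \<open>h'\<close> shows that they are complete
  to each other, which \<open>no_complete_stable_pair\<close> excludes.\<close>

lemma N_eq:
  assumes p: "p \<in> V" "p \<sim> v" and q: "q \<in> V" "q \<sim> v" and pq: "p \<sim> q"
  shows "N p = N q"
proof (cases "N p \<inter> N q = {}")
  case False
  thus ?thesis
    using N_common_subset[OF p q pq] N_common_subset[OF q p adj_sym[OF pq]] by blast
next
  case True
  have cross: "h \<sim> h'" if "h \<in> N p" "h' \<in> N q" for h h'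
  proof -
    have "h \<in> V" "h' \<in> V" "p \<sim> h" "\<not> q \<sim> h" "\<not> p \<sim> h'" "q \<sim> h'" "\<not> v \<sim> h" "\<not> v \<sim> h'"
      using that True H v unfolding N_def by blast+
    thus ?thesis using bull_freeD[OF bull, of p q v h h'] p q pq v adj_commute by blast
  qed
  have sub: "N u \<subseteq> H" for u unfolding N_def by blast
  have False
    by (rule no_complete_stable_pair[OF H(1) sub N_nonempty[OF p] stable_N[OF p] P4_free_diff_N[OF p]
      sub N_nonempty[OF q] stable_N[OF q] P4_free_diff_N[OF q] True cross closed_N[OF p] closed_N[OF q]])
  thus ?thesis ..
qed

text \<open>If \<open>w\<close> is complete to \<open>Q\<close>, either some vertex of
  \<open>Z\<close> is dominated or \<open>Z\<close> is nested. If not, the cograph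
  \<open>insert w Q\<close> yields a vertex \<open>t\<close> that dominates or is dominated.\<close>

lemma no_distinguishing_vertex:
  assumes p: "p \<in> V" "p \<sim> v" and q: "q \<in> V" "q \<sim> v" and pq: "p \<sim> q"
    and w: "w \<in> V" "w \<notin> H" "\<not> w \<sim> v" "w \<sim> p" "\<not> w \<sim> q"
  shows False
proof -
  define Z where "Z = N p"
  define Q where "Q = H - Z"
  have Zq: "Z = N q" using N_eq[OF p q pq] Z_def by simp
  have Z: "stable Z" "Z \<subseteq> H" "Z \<noteq> {}" "Z \<subseteq> V"
    using stable_N[OF p] N_nonempty[OF p] H unfolding Z_def N_def by auto
  have Zadj: "p \<sim> z" "q \<sim> z" if "z \<in> Z" for z
    using that Zq unfolding Z_def N_def by auto
  have Qadj: "n \<in> V" "\<not> p \<sim> n" "\<not> q \<sim> n" if "n \<in> Q" for n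
    using that H unfolding Q_def Zq by (auto simp: N_def Z_def Zq[symmetric]) (use Zq in \<open>auto simp: N_def Z_def\<close>)
  have ZQ: "n \<in> Q" if "z \<in> Z" "n \<in> H" "z \<sim> n" for z n
    using Z that unfolding stable_def Q_def by blast
  \<comment> \<open>Bulls: triangle \<open>p\<close>, \<open>z\<close>, \<open>w\<close> with
    pendants \<open>v\<close>, \<open>n\<close> if \<open>w\<close> sees \<open>z\<close>; triangle
    \<open>p\<close>, \<open>z\<close>, \<open>q\<close> with pendants \<open>w\<close>,
    \<open>n\<close> if not.\<close>
  have F1: "w \<sim> n" if z: "z \<in> Z" and n: "n \<in> H" "z \<sim> n" for z n
  proof (rule ccontr)
    assume wn: "\<not> w \<sim> n"
    have nQ: "n \<in> Q" using ZQ z n by blast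
    have zV: "z \<in> V" using z Z by blast
    show False
    proof (cases "w \<sim> z")
      case True
      hence "v \<sim> n"
        using bull_freeD[OF bull, of p z w v n] p v w n wn Qadj[OF nQ] Zadj[OF z] zV H Z z adj_commute by blast
      thus False using v n by blast
    next
      case False
      thus False
        using bull_freeD[OF bull, of p z q w n] p q pq w n wn Qadj[OF nQ] Zadj[OF z] zV adj_commute by blast
    qed
  qed
  \<comment> \<open>\<open>w\<close> and \<open>Q\<close> are anticomplete to the edge
    \<open>q v\<close>.\<close>
  have F2: "P4_free (insert w Q)"
  proof (rule P4_free_subset)
    show "P4_free {x \<in> V. \<not> q \<sim> x \<and> \<not> v \<sim> x}" using P2P4 q v unfolding P2_P4_free_def by blast
    show "insert w Q \<subseteq> {x \<in> V. \<not> q \<sim> x \<and> \<not> v \<sim> x}"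
      using w Qadj v(2) adj_commute unfolding Q_def by blast
  qed
  \<comment> \<open>Forbidden bull: triangle \<open>w\<close>, \<open>z\<close>, \<open>n\<close>,
    with \<open>t\<close> pendant at \<open>w\<close> and \<open>q\<close> pendant at
    \<open>z\<close>.\<close>
  have F3: "t \<sim> n" if z: "z \<in> Z" "w \<sim> z" and n: "n \<in> H" "z \<sim> n" and t: "t \<in> Q" "w \<sim> t" "\<not> z \<sim> t" for z n t
  proof (rule ccontr)
    assume tn: "\<not> t \<sim> n"
    have nQ: "n \<in> Q" using ZQ z n by blast
    have zV: "z \<in> V" using z Z by blast
    have "t \<sim> q"
      using bull_freeD[OF bull, of w z n t q] w q z n t tn F1[of z n] Qadj[OF nQ] Qadj[OF t(1)] Zadj[OF z(1)] zV
        adj_commute by blast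
    thus False using Qadj[OF t(1)] adj_sym by blast
  qed
  show False
  proof (cases "\<forall>t\<in>Q. w \<sim> t")
    case True
    show False
    proof (cases "\<exists>z\<in>Z. w \<sim> z")
      case True
      then obtain z where z: "z \<in> Z" "w \<sim> z" by blast
      obtain K where K: "K \<subseteq> H" "cliq K" "card K = om H" "K \<inter> Z = {}"
        using minimal_imperfect_avoid_stable[OF H(1) Z(2,1)] by blast
      have "\<exists>t\<in>Q. \<not> z \<sim> t"
      proof (rule ccontr)
        assume "\<not> ?thesis"
        hence "x \<sim> z" if "x \<in> K" for x using that K adj_sym unfolding Q_def by blast
        hence "z \<in> K" using om_maximal[OF H_prime(5) K(1-3), of z] z Z by blast
        thus False using K z by blast
      qed
      then obtain t where t: "t \<in> Q" "\<not> z \<sim> t" by blast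
      show False
      proof (rule minimal_imperfect_not_dominated[OF H(1), of z t])
        fix a assume "a \<in> H" "a \<sim> z"
        thus "a = t \<or> a \<sim> t" using F3[of z a t] z t \<open>\<forall>t\<in>Q. w \<sim> t\<close> adj_commute by blast
      qed (use z t Z in \<open>auto simp: Q_def\<close>)
    next
      case False
      show False
      proof (rule no_nested_stable[OF H(1) Z(2,1)])
        show "P4_free (H - Z)" using P4_free_diff_N[OF p] unfolding Z_def .
        show "edge_closed Z (H - Z)" using closed_N[OF p] unfolding Z_def .
        show "edge_nested Z (H - Z)"
          unfolding edge_nested_def
        proof (intro ballI impI, rule ccontr)
          fix d d' z z'
          assume d: "d \<in> H - Z" "d' \<in> H - Z" "z \<in> Z" "z' \<in> Z" "d \<sim> d'" "z \<sim> d" "z' \<sim> d'"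
            and no: "\<not> (z \<sim> d' \<or> z' \<sim> d)"
          have "w \<sim> d" "w \<sim> d'" "\<not> w \<sim> z" "\<not> w \<sim> z'" using True False d unfolding Q_def by auto
          \<comment> \<open>Triangle \<open>d\<close>, \<open>d'\<close>, \<open>w\<close> with
            pendants \<open>z\<close> at \<open>d\<close> and \<open>z'\<close> at
            \<open>d'\<close>.\<close>
          hence "z \<sim> z'"
            using bull_freeD[OF bull, of d d' w z z'] no d w(1) H Z(2) adj_commute by blast
          thus False using Z d unfolding stable_def by blast
        qed
      qed
    qed
  next
    case False
    then obtain t0 where t0: "t0 \<in> Q" "\<not> w \<sim> t0" by blast
    let ?W = "insert w Q"
    have wQ: "w \<notin> Q" using w unfolding Q_def by blast
    \<comment> \<open>As \<open>H\<close> is connected, an edge leaves \<open>Y\<close>; it ends in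
      \<open>Z\<close>, so by \<open>F1\<close> its end in \<open>Y\<close> is adjacent to
      \<open>w\<close>.\<close>
    have reach: False if Y: "Y \<subseteq> Q" "Y \<noteq> {}" "\<And>y x. y \<in> Y \<Longrightarrow> x \<in> ?W - Y \<Longrightarrow> \<not> y \<sim> x" for Y
    proof -
      have "Y \<subseteq> H" "Y \<noteq> H" using Y(1) Z unfolding Q_def by blast+
      then obtain y x where yx: "y \<in> Y" "x \<in> H - Y" "y \<sim> x"
        using connE[OF H_prime(3), of Y] Y(2) by blast
      have "x \<in> Z" using Y(3)[of y x] yx unfolding Q_def by blast
      hence "w \<sim> y" using F1[of x y] yx Y(1) adj_sym unfolding Q_def by blast
      thus False using Y(3)[of y w] Y(1) yx wQ adj_sym by blast
    qed
    have connW: "conn ?W"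
      unfolding conn_def
    proof (intro allI impI, rule ccontr)
      fix Y assume Y: "Y \<subseteq> ?W" "Y \<noteq> {}" "Y \<noteq> ?W" and no: "\<not> (\<exists>x\<in>Y. \<exists>y\<in>?W - Y. x \<sim> y)"
      show False
      proof (cases "w \<in> Y")
        case True
        have "\<not> y \<sim> x" if "y \<in> ?W - Y" "x \<in> ?W - (?W - Y)" for x y using that no adj_commute by blast
        moreover have "?W - Y \<subseteq> Q" using True by blast
        moreover have "?W - Y \<noteq> {}" using Y by blast
        ultimately show False using reach[of "?W - Y"] by blast
      next
        case False
        thus False using reach[of Y] Y no by blast
      qed
    qed
    have finW: "finite ?W" using H_prime(5) unfolding Q_def by simp
    interpret co: graph_relation "\<lambda>x y. x \<noteq> y \<and> \<not> x \<sim> y" by (rule complement)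
    obtain J where J: "w \<in> J" "J \<subseteq> ?W" "co.conn J" "\<And>a b. a \<in> J \<Longrightarrow> b \<in> ?W - J \<Longrightarrow> \<not> (a \<noteq> b \<and> \<not> a \<sim> b)"
      using co.component_exists[of w ?W] by (metis insertI1)
    have cJ: "coconn J" using J(3) co_defs by simp
    have JX: "a \<sim> b" "b \<sim> a" if "a \<in> J" "b \<in> ?W - J" for a b
      using J(4)[of a b] that adj_commute by blast+
    have t0J: "t0 \<in> J" "t0 \<noteq> w" using JX(1)[OF J(1), of t0] t0 wQ by blast+
    have "\<not> coconn ?W"
      using P4_free_cases[OF finW F2, of w t0] t0 t0J connW by blast
    hence "J \<noteq> ?W" using cJ by blast
    have "\<not> conn J"
      using P4_free_cases[OF finite_subset[OF J(2) finW] P4_free_subset[OF F2 J(2)] J(1) t0J(1)] t0J(2) cJ by blast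
    then obtain C where C: "C \<subseteq> J" "C \<noteq> {}" "C \<noteq> J" "\<And>c d. c \<in> C \<Longrightarrow> d \<in> J - C \<Longrightarrow> \<not> c \<sim> d"
      unfolding conn_def by blast
    \<comment> \<open>\<open>L\<close> is a union of components of \<open>J\<close> without
      \<open>w\<close>. By \<open>F1\<close> it has no neighbour in \<open>Z\<close>, so it is a
      module of \<open>H\<close> and hence a single vertex \<open>t\<close>, whose neighbours in
      \<open>H\<close> are all complete to \<open>J\<close>.\<close>
    obtain L where L: "L \<subseteq> J" "L \<noteq> {}" "w \<notin> L" "\<And>c d. c \<in> L \<Longrightarrow> d \<in> J - L \<Longrightarrow> \<not> c \<sim> d"
    proof (cases "w \<in> C")
      case False
      thus thesis using that[of C] C by blast
    next
      case True
      have "\<not> c \<sim> d" if "c \<in> J - C" "d \<in> J - (J - C)" for c d using that C adj_commute by blast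
      moreover have "J - C \<noteq> {}" using C by blast
      ultimately show thesis using that[of "J - C"] True by blast
    qed
    have LQ: "L \<subseteq> Q" using L J by blast
    have Lw: "\<not> w \<sim> l" if "l \<in> L" for l using L(4)[of l w] L(3) J(1) that adj_commute by blast
    have LZ: "\<not> z \<sim> l" if "l \<in> L" "z \<in> Z" for l z
      using F1[of z l] Lw that LQ unfolding Q_def by blast
    have "is_module L H"
      unfolding is_module_def
    proof (intro conjI ballI impI)
      show "L \<subseteq> H" using LQ unfolding Q_def by blast
      fix y a b assume y: "y \<in> H - L" "a \<in> L" "b \<in> L" "y \<sim> a"
      have "y \<in> Q" using LZ y unfolding Q_def by blast
      moreover have "y \<notin> J" using L(4)[of a y] y adj_sym by blast
      ultimately show "y \<sim> b" using JX(2)[of b y] y L by blast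
    qed
    moreover have "L \<noteq> H" using LQ Z unfolding Q_def by blast
    ultimately have L1: "x = y" if "x \<in> L" "y \<in> L" for x y
      using H_prime(1) that unfolding indecomposable_def by blast
    obtain t where t: "t \<in> L" using L by blast
    have tH: "t \<in> H" "t \<in> Q" using t LQ unfolding Q_def by blast+
    have Nt: "a \<in> ?W - J" if "a \<in> H" "a \<sim> t" for a
    proof -
      have "a \<in> Q" using LZ t that unfolding Q_def by blast
      moreover have "a \<notin> L" using L1[of a t] t that adj_irrefl by blast
      moreover have "a \<notin> J - L" using L(4)[of t a] t that adj_sym by blast
      ultimately show ?thesis by blast
    qed
    obtain z where z: "z \<in> Z" using Z by blast
    have zH: "z \<in> H" using z Z by blast
    show False
    \<comment> \<open>A neighbour of \<open>z\<close> in \<open>J\<close> dominates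
      \<open>t\<close>; if there is none, all neighbours of \<open>z\<close> in \<open>H\<close> are
      complete to \<open>J\<close>, and \<open>t\<close> dominates \<open>z\<close>.\<close>
    proof (cases "\<exists>n\<in>H. n \<in> J \<and> z \<sim> n")
      case True
      then obtain n where n: "n \<in> H" "n \<in> J" "z \<sim> n" by blast
      have "n \<noteq> t" using LZ[OF t z] n by blast
      show False
      proof (rule minimal_imperfect_not_dominated[OF H(1) tH(1) n(1)])
        show "t \<noteq> n" using \<open>n \<noteq> t\<close> by blast
        show "a = n \<or> a \<sim> n" if "a \<in> H" "a \<sim> t" for a using JX(2)[OF n(2) Nt[OF that]] by blast
      qed
    next
      case False
      show False
      proof (rule minimal_imperfect_not_dominated[OF H(1) zH tH(1)])
        show "z \<noteq> t" using z tH unfolding Q_def by blast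
        fix a assume a: "a \<in> H" "a \<sim> z"
        hence "a \<in> ?W - J" using False ZQ[of z a] z adj_sym by blast
        thus "a = t \<or> a \<sim> t" using JX(2)[of t a] t L by blast
      qed
    qed
  qed
qed

text \<open>The component of \<open>p\<close> and \<open>q\<close> among the neighbours of
  \<open>v\<close> is not a module, so some \<open>w\<close> distinguishes the ends of an edge
  \<open>c d\<close> of it. By the choice of the component \<open>w\<close> misses \<open>v\<close>,
  and \<open>w\<close> is not in \<open>H\<close> as \<open>N c = N d\<close>.\<close>

lemma no_triangle_at_v:
  assumes p: "p \<in> V" "p \<sim> v" and q: "q \<in> V" "q \<sim> v" and pq: "p \<sim> q"
  shows False
proof -
  let ?S = "{u \<in> V. u \<sim> v}"
  have pS: "p \<in> ?S" using p by blast
  obtain U where U: "p \<in> U" "U \<subseteq> ?S" "conn U" "\<And>d e. d \<in> U \<Longrightarrow> e \<in> ?S - U \<Longrightarrow> \<not> d \<sim> e"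
    using component_exists[OF pS] by metis
  have qU: "q \<in> U" using U(1) U(4)[of p q] q pq by blast
  have "\<not> is_module U V"
  proof
    assume "is_module U V"
    moreover have "U \<noteq> V" using U(2) v(1) adj_irrefl by blast
    ultimately have "p = q" using V U(1) qU unfolding indecomposable_def by blast
    thus False using pq adj_irrefl by blast
  qed
  then obtain w a b where w: "w \<in> V - U" "a \<in> U" "b \<in> U" "w \<sim> a" "\<not> w \<sim> b"
    using U(2) unfolding is_module_def by blast
  obtain c d where cd: "c \<in> U" "d \<in> U" "c \<sim> d" "w \<sim> c" "\<not> w \<sim> d"
    using conn_mixed[OF U(3), of a "\<lambda>x. w \<sim> x" b] w by blast
  have c: "c \<in> V" "c \<sim> v" "d \<in> V" "d \<sim> v" using cd U(2) by blast+
  have "\<not> w \<sim> v" using U(4)[of c w] cd w adj_sym by blast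
  moreover have "w \<notin> H"
  proof
    assume "w \<in> H"
    moreover have "N c = N d" using N_eq c cd by blast
    ultimately show False using cd adj_commute unfolding N_def by blast
  qed
  ultimately show False
    using no_distinguishing_vertex[OF c cd(3)] w cd by blast
qed

end

subsection \<open>Translation to the definitions of the statement\<close>

lemma (in graph_relation) om_le_col:
  assumes "finite S" "col S k"
  shows "om S \<le> k"
proof -
  obtain K where K: "K \<subseteq> S" "cliq K" "card K = om S" using om_attained[OF assms(1)] by blast
  obtain c where c: "\<forall>x\<in>S. c x < k" "\<forall>x\<in>S. \<forall>y\<in>S. x \<sim> y \<longrightarrow> c x \<noteq> c y"
    using assms(2) unfolding col_def by blast
  have "inj_on c K"
  proof (rule inj_onI, rule ccontr)
    fix x y assume "x \<in> K" "y \<in> K" "c x = c y" "x \<noteq> y"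
    moreover from this have "x \<sim> y" using K(2) unfolding cliq_def by metis
    ultimately show False using c(2) K(1) by blast
  qed
  moreover have "c ` K \<subseteq> {..<k}" using c K by blast
  ultimately show ?thesis using K(3) card_inj_on_le[of c K "{..<k}"] by simp
qed

lemma contains_inducedI:
  assumes "inj_on f (verts H)" "f ` verts H \<subseteq> verts G"
    and "\<forall>u\<in>verts H. \<forall>v\<in>verts H. {u, v} \<in> edges H \<longleftrightarrow> {f u, f v} \<in> edges G"
  shows "contains_induced G H"
  unfolding contains_induced_def isomorphic_def
  by (intro exI[of _ "f ` verts H"] conjI exI[of _ f])
    (use assms in \<open>auto simp: bij_betw_def induced_def\<close>)

lemma graph_relation_edges:
  assumes "simple_graph G"
  shows "graph_relation (\<lambda>u v. {u, v} \<in> edges G)"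
proof
  show "{y, x} \<in> edges G" if "{x, y} \<in> edges G" for x y using that by (simp add: insert_commute)
  show "{x, x} \<notin> edges G" for x
    using assms unfolding simple_graph_def nsets_def by auto
qed

context
  fixes G :: "'a ugraph"
  assumes G: "simple_graph G"
begin

interpretation graph_relation "\<lambda>u v. {u, v} \<in> edges G"
  using G by (rule graph_relation_edges)

lemma fin: "finite (verts G)"
  using G unfolding simple_graph_def by blast

lemma clique_number_induced: "clique_number (induced G X) = om X"
proof -
  have "clique K (edges (induced G X)) \<longleftrightarrow> cliq K" if "K \<subseteq> X" for K
    using that unfolding clique_def cliq_def induced_def by auto
  hence "{card K | K. K \<subseteq> X \<and> clique K (edges (induced G X))} = {card K | K. K \<subseteq> X \<and> cliq K}"
    by blast
  thus ?thesis unfolding clique_number_def om_def by (simp add: induced_def)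
qed

lemma clique_number_eq: "clique_number G = om (verts G)"
  unfolding clique_number_def om_def clique_def cliq_def ..

lemma colourable_induced: "colourable (induced G X) k \<longleftrightarrow> col X k"
proof
  assume "colourable (induced G X) k"
  then obtain c where c: "c \<in> X \<rightarrow> {..<k}" "\<forall>u v. {u, v} \<in> edges (induced G X) \<longrightarrow> c u \<noteq> c v"
    unfolding colourable_def by (auto simp: induced_def)
  show "col X k" unfolding col_def
    by (intro exI[of _ c]) (use c in \<open>auto simp: induced_def\<close>)
next
  assume "col X k"
  then obtain c where c: "\<forall>x\<in>X. c x < k" "\<forall>x\<in>X. \<forall>y\<in>X. {x, y} \<in> edges G \<longrightarrow> c x \<noteq> c y"
    unfolding col_def by blast
  show "colourable (induced G X) k" unfolding colourable_def
    by (intro bexI[of _ c]) (use c in \<open>auto simp: induced_def\<close>)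
qed

lemma perfect_inducedI:
  assumes "finite A" "\<And>X. X \<subseteq> A \<Longrightarrow> col X (om X)"
  shows "perfect (induced G A)"
  unfolding perfect_def
proof (intro allI impI)
  fix X assume "X \<subseteq> verts (induced G A)"
  hence X: "X \<subseteq> A" by (simp add: induced_def)
  hence eq: "induced (induced G A) X = induced G X" by (auto simp: induced_def)
  have "finite X" using X assms finite_subset by blast
  have "chromatic_number (induced G X) = om X"
    unfolding chromatic_number_def colourable_induced
    by (intro Least_equality assms(2) X om_le_col \<open>finite X\<close>)
  thus "chromatic_number (induced (induced G A) X) = clique_number (induced (induced G A) X)"
    by (simp add: eq clique_number_induced)
qed

section \<open>Homogeneous sets and forbidden induced subgraphs\<close>

lemma indecomposable_verts:
  assumes "\<not> (\<exists>X. homogeneous_set G X)"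
  shows "indecomposable (verts G)"
  unfolding indecomposable_def
proof (intro allI impI ballI, rule ccontr)
  fix X x y assume X: "is_module X (verts G)" "X \<noteq> verts G" "x \<in> X" "y \<in> X" "x \<noteq> y"
  have sub: "X \<subset> verts G" using X unfolding is_module_def by blast
  have "homogeneous_set G X"
    unfolding homogeneous_set_def
  proof (intro conjI ballI)
    have "card {x, y} \<le> card X" using X sub fin finite_subset by (intro card_mono) auto
    thus "1 < card X" using X by simp
    show "card X < card (verts G)" using sub fin by (rule psubset_card_mono[rotated])
    fix v assume v: "v \<in> verts G - X"
    show "complete_to G {v} X \<or> anticomplete_to G {v} X"
      using X(1) v unfolding complete_to_def anticomplete_to_def is_module_def by blast
  qed (use sub in blast)
  thus False using assms by blast
qed

lemma bull_free_verts:
  assumes "\<not> contains_induced G bull"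
  shows "bull_free (verts G)"
  unfolding bull_free_def
proof (intro ballI impI, rule ccontr)
  let ?E = "\<lambda>u v. {u, v} \<in> edges G"
  fix x1 x2 x3 y z
  assume mem: "x1 \<in> verts G" "x2 \<in> verts G" "x3 \<in> verts G" "y \<in> verts G" "z \<in> verts G"
    and adj: "?E x1 x2" "?E x1 x3" "?E x2 x3" "?E x1 y" "?E x2 z"
    and non: "\<not> ?E y x2" "\<not> ?E y x3" "\<not> ?E z x1" "\<not> ?E z x3" "\<not> ?E y z"
  define f :: "nat \<Rightarrow> 'a" where
    "f i = (if i = 1 then x1 else if i = 2 then x2 else if i = 3 then x3 else if i = 4 then y else z)" for i
  have f: "f 1 = x1" "f (Suc 0) = x1" "f 2 = x2" "f 3 = x3" "f 4 = y" "f 5 = z" by (simp_all add: f_def)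
  have ne: "x1 \<noteq> x2" "x1 \<noteq> x3" "x2 \<noteq> x3" "x1 \<noteq> y" "x2 \<noteq> z" using adj adj_irrefl by metis+
  \<comment> \<open>The vertices of each pair differ in their adjacency to a third vertex.\<close>
  have ne2: "y \<noteq> x2" "y \<noteq> x3" "z \<noteq> x1" "z \<noteq> x3" "y \<noteq> z"
    using adj non adj_commute by metis+
  have sym: "\<not> ?E x2 y" "\<not> ?E x3 y" "\<not> ?E x1 z" "\<not> ?E x3 z" "\<not> ?E z y"
    "?E x2 x1" "?E x3 x1" "?E x3 x2" "?E y x1" "?E z x2"
    using adj non adj_commute by blast+
  have irr: "{u} \<notin> edges G" for u using adj_irrefl[of u] by simp
  have "contains_induced G bull"
  proof (rule contains_inducedI[of f])
    show "inj_on f (verts bull)" using ne ne2 by (auto simp: bull_def inj_on_def f)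
    show "f ` verts bull \<subseteq> verts G" using mem by (auto simp: bull_def f)
    show "\<forall>u\<in>verts bull. \<forall>v\<in>verts bull. {u, v} \<in> edges bull \<longleftrightarrow> {f u, f v} \<in> edges G"
      using adj non sym irr by (simp add: bull_def f doubleton_eq_iff)
  qed
  thus False using assms by blast
qed

lemma P2_P4_free_verts:
  assumes "\<not> contains_induced G (disjoint_union (path_graph 2) (path_graph 4))"
  shows "P2_P4_free (verts G)"
  unfolding P2_P4_free_def P4_free_def
proof (intro ballI impI, rule ccontr)
  let ?E = "\<lambda>u v. {u, v} \<in> edges G"
  fix e e' a b c d
  let ?S = "{x \<in> verts G. \<not> ?E e x \<and> \<not> ?E e' x}"
  assume mem: "e \<in> verts G" "e' \<in> verts G" "a \<in> ?S" "b \<in> ?S" "c \<in> ?S" "d \<in> ?S"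
    and adj: "?E e e'" "?E a b" "?E b c" "?E c d"
    and non: "\<not> ?E a c" "\<not> ?E b d" "\<not> ?E a d"
  let ?H = "disjoint_union (path_graph 2) (path_graph 4)"
  have verts2: "{..<2} = {0, 1::nat}" and verts4: "{..<4} = {0, 1, 2, 3::nat}" by auto
  have vH: "verts ?H = {Inl 0, Inl 1, Inr 0, Inr 1, Inr 2, Inr 3}"
    unfolding disjoint_union_def path_graph_def ugraph.simps verts2 verts4 by auto
  have path2: "edges (path_graph 2) = {{0, 1}}"
    unfolding path_graph_def by (auto simp: less_Suc_eq numeral_eq_Suc)
  have path4: "edges (path_graph 4) = {{0, 1}, {1, 2}, {2, 3}}"
    unfolding path_graph_def by (auto simp: less_Suc_eq numeral_eq_Suc)
  have eH: "edges ?H = {{Inl 0, Inl 1}, {Inr 0, Inr 1}, {Inr 1, Inr 2}, {Inr 2, Inr 3}}"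
    unfolding disjoint_union_def ugraph.simps path2 path4 by auto
  define f :: "nat + nat \<Rightarrow> 'a" where
    "f = case_sum (\<lambda>i. if i = 0 then e else e')
       (\<lambda>i. if i = 0 then a else if i = 1 then b else if i = 2 then c else d)"
  have f: "f (Inl 0) = e" "f (Inl 1) = e'" "f (Inl (Suc 0)) = e'" "f (Inr 0) = a" "f (Inr 1) = b"
    "f (Inr (Suc 0)) = b" "f (Inr 2) = c" "f (Inr 3) = d" by (simp_all add: f_def)
  have anti: "\<not> ?E e x" "\<not> ?E e' x" "\<not> ?E x e" "\<not> ?E x e'" if "x \<in> {a, b, c, d}" for x
    using that mem adj_commute by blast+
  have ne: "e \<noteq> e'" "a \<noteq> b" "b \<noteq> c" "c \<noteq> d" using adj adj_irrefl by metis+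
  have ne2: "a \<noteq> c" "b \<noteq> d" "a \<noteq> d" using adj non adj_commute by metis+
  have ne3: "x \<noteq> e" "x \<noteq> e'" if "x \<in> {a, b, c, d}" for x
    using anti[OF that] adj(1) adj_commute by metis+
  have sym: "?E e' e" "?E b a" "?E c b" "?E d c" "\<not> ?E c a" "\<not> ?E d b" "\<not> ?E d a"
    using adj non adj_commute by blast+
  have irr: "{u} \<notin> edges G" for u using adj_irrefl[of u] by simp
  have "contains_induced G ?H"
  proof (rule contains_inducedI[of f])
    show "inj_on f (verts ?H)"
      unfolding vH using ne ne2 ne3[of a] ne3[of b] ne3[of c] ne3[of d]
      by (auto simp: inj_on_def f)
    show "f ` verts ?H \<subseteq> verts G" unfolding vH using mem by (auto simp: f)
    show "\<forall>u\<in>verts ?H. \<forall>v\<in>verts ?H. {u, v} \<in> edges ?H \<longleftrightarrow> {f u, f v} \<in> edges G"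
      unfolding vH eH using adj non sym irr anti[of a] anti[of b] anti[of c] anti[of d]
      by (simp add: f doubleton_eq_iff)
  qed
  thus False using assms by blast
qed

lemma perfect_division_if_no_homogeneous_set:
  assumes P2P4: "\<not> contains_induced G (disjoint_union (path_graph 2) (path_graph 4))"
    and bull: "\<not> contains_induced G bull"
    and omega: "clique_number G \<ge> 3"
    and hom: "\<not> (\<exists>X. homogeneous_set G X)"
  shows "has_perfect_division G"
proof -
  let ?V = "verts G"
  let ?E = "\<lambda>u v. {u, v} \<in> edges G"
  obtain K where K: "K \<subseteq> ?V" "cliq K" "card K = om ?V" using om_attained[OF fin] by blast
  obtain K3 where K3: "K3 \<subseteq> K" "card K3 = 3"
    using omega K(3) clique_number_eq obtain_subset_with_card_n[of 3 K] by metis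
  then obtain v p q where vpq: "K3 = {v, p, q}" "v \<noteq> p" "v \<noteq> q" "p \<noteq> q"
    by (metis card_3_iff)
  have cl3: "cliq K3" using cliq_subset[OF K(2) K3(1)] .
  have adj: "?E p v" "?E q v" "?E p q"
    using cl3 vpq unfolding cliq_def by auto
  have mem: "v \<in> ?V" "p \<in> ?V" "q \<in> ?V" using vpq K3 K by auto
  define A where "A = {x \<in> ?V. \<not> ?E v x}"
  define B where "B = {x \<in> ?V. ?E v x}"
  have "perfect (induced G A)"
  proof (rule perfect_inducedI)
    show "finite A" using fin unfolding A_def by simp
    fix X assume X: "X \<subseteq> A"
    show "col X (om X)"
    proof (rule ccontr)
      assume "\<not> col X (om X)"
      moreover have "finite X" using X fin unfolding A_def by (auto intro: finite_subset)
      ultimately obtain H where H: "H \<subseteq> X" "minimal_imperfect H"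
        using imperfect_obtains_minimal by blast
      interpret imperfect_nonneighbours ?E ?V H v
      proof
        show "bull_free ?V" using bull by (rule bull_free_verts)
        show "P2_P4_free ?V" using P2P4 by (rule P2_P4_free_verts)
        show "indecomposable ?V" using hom by (rule indecomposable_verts)
        show "H \<subseteq> ?V" "\<And>h. h \<in> H \<Longrightarrow> \<not> ?E v h" using H X unfolding A_def by auto
      qed (use H mem in auto)
      show False using no_triangle_at_v[of p q] mem adj by blast
    qed
  qed
  moreover have "clique_number (induced G B) < clique_number G"
  proof -
    have finB: "finite B" using fin unfolding B_def by simp
    obtain L where L: "L \<subseteq> B" "cliq L" "card L = om B" using om_attained[OF finB] by blast
    \<comment> \<open>All of \<open>L\<close> is adjacent to \<open>v\<close>, so \<open>v\<close>
      enlarges a largest clique of \<open>B\<close>.\<close>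
    have "cliq (insert v L)"
      using L adj_commute unfolding B_def by (intro cliq_insert) auto
    moreover have "insert v L \<subseteq> ?V" using L mem unfolding B_def by blast
    ultimately have "card (insert v L) \<le> om ?V" using om_ge[OF fin] by blast
    moreover have "v \<notin> L" using L adj_irrefl[of v] unfolding B_def by blast
    moreover have "finite L" using L finB finite_subset by blast
    ultimately show ?thesis using L by (simp add: clique_number_induced clique_number_eq)
  qed
  moreover have "A \<union> B = ?V" "A \<inter> B = {}" unfolding A_def B_def by blast+
  ultimately show ?thesis unfolding has_perfect_division_def by blast
qed

end

theorem theorem1p1:
  fixes G :: "'a ugraph"
  assumes "simple_graph G"
    and "\<not> contains_induced G (disjoint_union (path_graph 2) (path_graph 4))"
    and "\<not> contains_induced G bull"
    and "clique_number G \<ge> 3"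
  shows "(\<exists>X. homogeneous_set G X) \<or> has_perfect_division G"
  using perfect_division_if_no_homogeneous_set[OF assms] by blast

end
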